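(* Let $p$ be a prime number and let $A\subset\mathbb{F}_p$ be a set such that $A\cap(-A)=\emptyset$, where $-A=\{-a\mid a\in A\}$. For every integer $\alpha\in[0,|A|]$, \[|\Sigma_\alpha(A)|=|\Sigma^\alpha(A)|\geqslant\min\left\{p,\ \frac{|A|(|A|+1)}{2}-\frac{\alpha(\alpha+1)}{2}+1\right\}.\]
   Context: For $A\subset\mathbb{F}_p$ and an integer $k\in[0,|A|]$, let $k^\wedge A=\{a_1+\dots+a_k\mid a_i\in A,\ a_i\neq a_j \text{ for } i\neq j\}$ denote the set of sums of $k$ pairwise distinct elements of $A$ (with $0^\wedge A=\{0\}$). Define $\Sigma_\alpha(A)=\bigcup_{k=\alpha}^{|A|}(k^\wedge A)$, the set of subsums of at least $\alpha$ pairwise distinct elements of $A$, and $\Sigma^\alpha(A)=\bigcup_{k=0}^{|A|-\alpha}(k^\wedge A)$, the set of subsums of at most $|A|-\alpha$ pairwise distinct elements of $A$. *)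

theory Defs
  imports "Berlekamp_Zassenhaus.Finite_Field"
begin

definition restricted_sumset :: "nat \<Rightarrow> 'a::comm_monoid_add set \<Rightarrow> 'a set" where
  "restricted_sumset k A =
     {(\<Sum>i = 1..k. a i) | a :: nat \<Rightarrow> 'a. (\<forall>i\<in>{1..k}. a i \<in> A) \<and>
        (\<forall>i\<in>{1..k}. \<forall>j\<in>{1..k}. i \<noteq> j \<longrightarrow> a i \<noteq> a j)}"

definition subsums_at_least :: "nat \<Rightarrow> 'a::comm_monoid_add set \<Rightarrow> 'a set" where
  "subsums_at_least \<alpha> A = (\<Union>k\<in>{\<alpha>..card A}. restricted_sumset k A)"

text \<open>The parameter \<open>\<alpha>\<close> counts the elements left out of a sum; the natural-number
  subtraction is the intended one for \<open>\<alpha> \<le> card A\<close>.\<close>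

definition subsums_omitting :: "nat \<Rightarrow> 'a::comm_monoid_add set \<Rightarrow> 'a set" where
  "subsums_omitting \<alpha> A = (\<Union>k\<in>{0..card A - \<alpha>}. restricted_sumset k A)"

end

theory Submission
  imports Defs "HOL-Combinatorics.Transposition"
begin

text \<open>
  Write \<open>\<omega>(x) = \<Prod>i<j. (x\<^sub>i - x\<^sub>j) / (x\<^sub>i + x\<^sub>j)\<close>. For distinct \<open>x\<^sub>i\<close> with nonzero
  pairwise sums, the signed sum of \<open>\<omega>(x\<^sub>S) \<omega>(x\<^sub>T) (\<Sum>i\<in>S. x\<^sub>i)^n\<close> over all partitions
  \<open>I = S \<union> T\<close> of the index set equals the polynomial
  \<open>n! \<Sum>\<^sub>l \<omega>(l) / (\<Prod>i. l\<^sub>i!) x^l\<close>, where \<open>l\<close> ranges over the exponent vectors with all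
  \<open>l\<^sub>i \<ge> 1\<close> and \<open>\<Sum>l = n\<close>. Both sides satisfy the same recurrence in \<open>n\<close>, which on either
  side is a partial fraction identity.

  Suppose that the sums of at most \<open>k\<close> elements of \<open>A\<close> form a set of size at most \<open>m < p\<close>. A
  monic polynomial \<open>f\<close> of degree \<open>m\<close> vanishes on it, so the left-hand sides, combined with the
  coefficients of \<open>f\<close>, vanish for all distinct \<open>x\<^sub>i \<in> A\<close>; the right-hand sides are antisymmetric
  and divisible by every \<open>x\<^sub>i\<close>, so their combination vanishes for all \<open>x\<^sub>i \<in> A \<union> {0}\<close>. If
  \<open>I \<subseteq> {1..|A|}\<close> has at most \<open>k\<close> elements and \<open>\<Sum>I = m\<close>, then the coefficient of
  \<open>\<Prod>i\<in>I. x\<^sub>i^i\<close> is nonzero and of top degree, contradicting the combinatorial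
  Nullstellensatz. Such an \<open>I\<close> exists for every \<open>m\<close> up to \<open>|A| + (|A| - 1) + \<dots>\<close> (\<open>k\<close> terms).
\<close>

section \<open>Partial fractions\<close>

text \<open>The summands of the first claim are the residues of the rational function with zeros
  \<open>v j\<close> and poles \<open>u j\<close>; the second claim is its partial fraction
  expansion, the first compares coefficients of \<open>1 / y\<close> at infinity. They share one
  induction because the residue at a new pole \<open>u a\<close> is obtained from the old expansion
  evaluated at \<open>u a\<close>.\<close>

lemma partial_fraction_weights:
  fixes u v :: "'b \<Rightarrow> 'a::field"
  assumes "finite I" "inj_on u I"
  shows "(\<Sum>i\<in>I. (u i - v i) * (\<Prod>j\<in>I-{i}. (u i - v j) / (u i - u j))) = (\<Sum>i\<in>I. u i - v i)"
    and "y \<notin> u ` I \<Longrightarrow> (\<Prod>j\<in>I. (y - v j) / (y - u j)) =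
      1 + (\<Sum>i\<in>I. (u i - v i) * (\<Prod>j\<in>I-{i}. (u i - v j) / (u i - u j)) / (y - u i))"
  using assms
proof (induction I arbitrary: y rule: finite_induct)
  case empty
  { case 1 then show ?case by simp }
  { case 2 then show ?case by simp }
next
  case (insert a I)
  define w where "w = (\<lambda>i. (u i - v i) * (\<Prod>j\<in>I-{i}. (u i - v j) / (u i - u j)))"
  define w' where "w' = (\<lambda>i. (u i - v i) * (\<Prod>j\<in>insert a I-{i}. (u i - v j) / (u i - u j)))"
  have w'_I: "w' i = w i * ((u i - v a) / (u i - u a))" if "i \<in> I" for i
  proof -
    have "insert a I - {i} = insert a (I - {i})" using that insert.hyps by auto
    then show ?thesis using insert.hyps by (simp add: w_def w'_def)
  qed
  have uia: "u i \<noteq> u a" if "i \<in> I" "inj_on u (insert a I)" for i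
    using that insert.hyps by (metis inj_on_def insertCI)
  { case 1
    have inj: "inj_on u I" and a: "u a \<notin> u ` I" using 1 insert.hyps by auto
    have w'a: "w' a = (u a - v a) * (1 + (\<Sum>i\<in>I. w i / (u a - u i)))"
      using insert.IH(2)[OF a inj] insert.hyps by (simp add: w_def w'_def)
    have "(\<Sum>i\<in>insert a I. w' i) = w' a + (\<Sum>i\<in>I. w i * ((u i - v a) / (u i - u a)))"
      using insert.hyps w'_I by simp
    also have "\<dots> = (u a - v a) + (\<Sum>i\<in>I. (u a - v a) * (w i / (u a - u i)) + w i * ((u i - v a) / (u i - u a)))"
      by (simp add: w'a ring_distribs sum.distrib sum_distrib_left)
    also have "(\<Sum>i\<in>I. (u a - v a) * (w i / (u a - u i)) + w i * ((u i - v a) / (u i - u a))) = sum w I"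
    proof (rule sum.cong[OF refl])
      fix i assume "i \<in> I"
      then have "u i - u a \<noteq> 0" "u a - u i = - (u i - u a)" using uia 1 by auto
      then show "(u a - v a) * (w i / (u a - u i)) + w i * ((u i - v a) / (u i - u a)) = w i"
        by (simp add: divide_simps) (simp add: algebra_simps)
    qed
    also have "sum w I = (\<Sum>i\<in>I. u i - v i)" using insert.IH(1)[OF inj] by (simp add: w_def)
    finally show ?case using insert.hyps by (simp add: w'_def) }
  { case 2
    have inj: "inj_on u I" and a: "u a \<notin> u ` I" and y: "y \<notin> u ` I" "y - u a \<noteq> 0"
      using 2 insert.hyps by auto
    have w'a: "w' a = (u a - v a) * (1 + (\<Sum>i\<in>I. w i / (u a - u i)))"
      using insert.IH(2)[OF a inj] insert.hyps by (simp add: w_def w'_def)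
    have "(\<Prod>j\<in>insert a I. (y - v j) / (y - u j)) = (y - v a) / (y - u a) * (1 + (\<Sum>i\<in>I. w i / (y - u i)))"
      using insert.IH(2)[OF y(1) inj] insert.hyps by (simp add: w_def)
    also have "\<dots> = (y - v a) / (y - u a) + (\<Sum>i\<in>I. (y - v a) / (y - u a) * (w i / (y - u i)))"
      by (simp add: ring_distribs sum_distrib_left)
    also have "(\<Sum>i\<in>I. (y - v a) / (y - u a) * (w i / (y - u i)))
       = (\<Sum>i\<in>I. w' i / (y - u i) + (u a - v a) / (y - u a) * (w i / (u a - u i)))"
    proof (rule sum.cong[OF refl])
      fix i assume i: "i \<in> I"
      have *: "u i - u a \<noteq> 0" "u a - u i \<noteq> 0" "y - u i \<noteq> 0" using uia[OF i] 2 y i by auto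
      have "w' i / (y - u i) + (u a - v a) / (y - u a) * (w i / (u a - u i)) =
        w i * ((u i - v a) / (u i - u a) / (y - u i) - (u a - v a) / (y - u a) / (u i - u a))"
        using * by (simp add: w'_I[OF i] divide_simps) (simp add: algebra_simps)
      also have "(u i - v a) / (u i - u a) / (y - u i) - (u a - v a) / (y - u a) / (u i - u a) =
         (y - v a) / (y - u a) / (y - u i)"
        using * y(2) by (simp add: divide_simps) (simp add: algebra_simps)
      finally show "(y - v a) / (y - u a) * (w i / (y - u i)) = w' i / (y - u i) + (u a - v a) / (y - u a) * (w i / (u a - u i))"
        by (simp add: mult.commute)
    qed
    also have "(y - v a) / (y - u a) + \<dots> = 1 + (w' a / (y - u a) + (\<Sum>i\<in>I. w' i / (y - u i)))"
    proof -
      have "(y - v a) / (y - u a) = 1 + (u a - v a) / (y - u a)"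
        using y(2) by (simp add: divide_simps)
      then show ?thesis
        by (simp add: w'a sum.distrib distrib_left add_divide_distrib sum_distrib_left sum_divide_distrib mult_ac)
    qed
    finally show ?case using insert.hyps by (simp add: w'_def) }
qed

section \<open>The alternating product\<close>

text \<open>With the sign \<open>inv_sign\<close> included, the factors of \<open>\<omega>\<close> become symmetric in \<open>i\<close> and \<open>j\<close>,
  so that any index, not only the least one, can be split off.\<close>

definition pair_prod :: "('b::linorder \<Rightarrow> 'b \<Rightarrow> 'a::comm_monoid_mult) \<Rightarrow> 'b set \<Rightarrow> 'a" where
  "pair_prod g I = (\<Prod>j\<in>I. \<Prod>i\<in>{i\<in>I. i < j}. g i j)"

lemma pair_prod_empty [simp]: "pair_prod g {} = 1"
  by (simp add: pair_prod_def)

text \<open>Since \<open>g\<close> is symmetric, the pairs with \<open>a\<close> as larger and as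
  smaller index merge into one product, and the position of \<open>a\<close> relative to
  \<open>I\<close> disappears.\<close>

lemma pair_prod_insert:
  assumes "finite I" "a \<notin> I" and sym: "\<And>i j. i \<noteq> j \<Longrightarrow> g i j = g j i"
  shows "pair_prod g (insert a I) = (\<Prod>j\<in>I. g a j) * pair_prod g I"
proof -
  have 1: "{i \<in> insert a I. i < j} = (if a < j then insert a {i\<in>I. i < j} else {i\<in>I. i < j})" for j
    by auto
  have "pair_prod g (insert a I) = (\<Prod>i\<in>{i\<in>I. i < a}. g i a) *
      (\<Prod>j\<in>I. (if a < j then g a j else 1) * (\<Prod>i\<in>{i\<in>I. i < j}. g i j))"
  proof -
    have "(\<Prod>i\<in>{i \<in> insert a I. i < j}. g i j) = (if a < j then g a j else 1) * (\<Prod>i\<in>{i\<in>I. i < j}. g i j)" for j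
      using assms(1,2) unfolding 1 by simp
    then show ?thesis using assms(1,2) by (simp add: pair_prod_def)
  qed
  also have "(\<Prod>i\<in>{i\<in>I. i < a}. g i a) = (\<Prod>i\<in>I. if i < a then g a i else 1)"
    using assms(1,2) by (subst prod.inter_filter[symmetric]) (auto intro!: prod.cong sym)
  also have "(\<Prod>j\<in>I. (if a < j then g a j else 1) * (\<Prod>i\<in>{i\<in>I. i < j}. g i j)) =
     (\<Prod>j\<in>I. if a < j then g a j else 1) * pair_prod g I"
    by (simp add: prod.distrib pair_prod_def)
  also have "(\<Prod>i\<in>I. if i < a then g a i else 1) * \<dots> =
      (\<Prod>i\<in>I. (if i < a then g a i else 1) * (if a < i then g a i else 1)) * pair_prod g I"
    by (simp add: prod.distrib mult.assoc)
  also have "(\<Prod>i\<in>I. (if i < a then g a i else 1) * (if a < i then g a i else 1)) = (\<Prod>i\<in>I. g a i)"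
    using assms(2) by (intro prod.cong) auto
  finally show ?thesis .
qed

definition inv_sign :: "'b::linorder \<Rightarrow> 'b \<Rightarrow> 'a::comm_ring_1" where
  "inv_sign i j = (if i < j then 1 else -1)"

lemma inv_sign_swap: "i \<noteq> j \<Longrightarrow> inv_sign i j = - inv_sign j i"
  by (auto simp: inv_sign_def)

text \<open>Inside \<open>pair_prod\<close> the first index is the smaller one, so the sign
  evaluates to 1. For evenly many indices with nonzero pair sums this is Schur's Pfaffian of the
  matrix with entries \<open>(x i - x j) / (x i + x j)\<close>.\<close>

definition omega :: "('b::linorder \<Rightarrow> 'a::field) \<Rightarrow> 'b set \<Rightarrow> 'a" where
  "omega x = pair_prod (\<lambda>i j. inv_sign i j * ((x i - x j) / (x i + x j)))"

lemma omega_empty [simp]: "omega x {} = 1"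
  by (simp add: omega_def)

lemma omega_insert:
  fixes x :: "'b::linorder \<Rightarrow> 'a::field"
  assumes "finite I" "a \<notin> I"
  shows "omega x (insert a I) =
    (\<Prod>j\<in>I. inv_sign a j) * (\<Prod>j\<in>I. (x a - x j) / (x a + x j)) * omega x I"
  unfolding omega_def
proof (subst pair_prod_insert[OF assms])
  fix i j :: 'b assume "i \<noteq> j"
  then show "inv_sign i j * ((x i - x j) / (x i + x j)) = inv_sign j i * ((x j - x i) / (x j + x i))"
    by (simp add: inv_sign_swap[of i j] add.commute[of "x j"] flip: minus_divide_left)
       (metis minus_diff_eq minus_divide_left mult_minus_right)
qed (simp only: prod.distrib)

lemma omega_cong: "(\<And>i. i \<in> I \<Longrightarrow> x i = y i) \<Longrightarrow> omega x I = omega y I"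
  unfolding omega_def pair_prod_def by (intro prod.cong refl) auto

lemma omega_swap:
  assumes "finite I" "a \<in> I" "b \<in> I" "a \<noteq> b"
  shows "omega (x \<circ> Transposition.transpose a b) I = - omega x I"
proof -
  define J where "J = I - {a, b}"
  have I: "I = insert a (insert b J)" and J: "finite J" "a \<notin> J" "b \<notin> J" "a \<notin> insert b J"
    using assms by (auto simp: J_def)
  let ?y = "x \<circ> Transposition.transpose a b"
  have y: "?y i = x i" if "i \<in> J" for i using that J by (auto simp: transpose_def)
  have o: "omega ?y J = omega x J" using y by (rule omega_cong)
  have pr: "(\<Prod>j\<in>J. (c - ?y j) / (c + ?y j)) = (\<Prod>j\<in>J. (c - x j) / (c + x j))" for c
    using y by (intro prod.cong) auto
  have "(x b - x a) / (x b + x a) = - ((x a - x b) / (x a + x b))"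
    by (metis add.commute minus_diff_eq minus_divide_left)
  moreover have "?y a = x b" "?y b = x a" by auto
  ultimately show ?thesis
    using J assms(4) by (simp add: I omega_insert pr o mult_ac del: comp_apply)
qed

lemma omega_eq_0:
  assumes "finite I" "a \<in> I" "b \<in> I" "a \<noteq> b" "x a = x b"
  shows "omega x I = 0"
proof -
  define J where "J = I - {a}"
  have I: "I = insert a J" and J: "finite J" "a \<notin> J" "b \<in> J"
    using assms by (auto simp: J_def)
  have "(\<Prod>j\<in>J. (x a - x j) / (x a + x j)) = 0" using J assms(5) by auto
  then show ?thesis using J by (simp add: I omega_insert)
qed

lemma omega_nonzero:
  fixes x :: "'b::linorder \<Rightarrow> 'a::field"
  assumes "finite I" "inj_on x I" "\<And>i j. i \<in> I \<Longrightarrow> j \<in> I \<Longrightarrow> i \<noteq> j \<Longrightarrow> x i + x j \<noteq> 0"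
  shows "omega x I \<noteq> 0"
  using assms
proof (induction I rule: finite_induct)
  case (insert a I)
  have "(\<Prod>j\<in>I. inv_sign a j) \<noteq> (0::'a)" using insert by (auto simp: inv_sign_def)
  moreover have "(\<Prod>j\<in>I. (x a - x j) / (x a + x j)) \<noteq> 0"
    using insert.prems insert.hyps by (auto simp: inj_on_def)
  moreover have "omega x I \<noteq> 0" using insert by auto
  ultimately show ?case using insert.hyps by (simp add: omega_insert)
qed simp

section \<open>Signed sums over subset sums\<close>

text \<open>\<open>tri_sign t = (-1) ^ (t * (t + 1) div 2)\<close>\<close>

fun tri_sign :: "nat \<Rightarrow> 'a::comm_ring_1" where
  "tri_sign 0 = 1"
| "tri_sign (Suc t) = (-1) ^ Suc t * tri_sign t"

lemma tri_sign_add: "tri_sign (a + b) = tri_sign a * tri_sign b * (-1) ^ (a * b)"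
  by (induction b) (simp_all add: power_add)

lemma tri_sign_square [simp]: "tri_sign t * tri_sign t = 1"
proof (induction t)
  case (Suc t)
  have "tri_sign (Suc t) * tri_sign (Suc t) = ((-1) ^ Suc t * (-1) ^ Suc t) * (tri_sign t * tri_sign t :: 'a)"
    by (simp only: tri_sign.simps mult_ac)
  then show ?case using Suc by (simp flip: power_mult_distrib)
qed simp

text \<open>For disjoint \<open>S\<close> and \<open>T\<close> this is the sign of the shuffle that
  puts \<open>S\<close> before \<open>T\<close>.\<close>

definition cross_sign :: "'b::linorder set \<Rightarrow> 'b set \<Rightarrow> 'a::comm_ring_1" where
  "cross_sign S T = (\<Prod>i\<in>S. \<Prod>j\<in>T. inv_sign i j)"

lemma cross_sign_insert_left:
  "finite S \<Longrightarrow> a \<notin> S \<Longrightarrow> cross_sign (insert a S) T = (\<Prod>j\<in>T. inv_sign a j) * cross_sign S T"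
  by (simp add: cross_sign_def)

lemma cross_sign_insert_right:
  assumes "finite T" "a \<notin> T" "a \<notin> S"
  shows "cross_sign S (insert a T) =
    (-1) ^ card S * (\<Prod>i\<in>S. inv_sign a i) * (cross_sign S T :: 'a::comm_ring_1)"
proof -
  have "(\<Prod>i\<in>S. inv_sign i a) = (\<Prod>i\<in>S. (-1) * inv_sign a i :: 'a)"
  proof (rule prod.cong[OF refl])
    fix i assume "i \<in> S"
    then have "i \<noteq> a" using assms by auto
    from inv_sign_swap[OF this] show "inv_sign i a = (-1 * inv_sign a i :: 'a)" by simp
  qed
  also have "\<dots> = (-1) ^ card S * (\<Prod>i\<in>S. inv_sign a i)"
    by (simp only: prod.distrib prod_constant)
  finally show ?thesis using assms(1,2) by (simp add: cross_sign_def prod.distrib)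
qed

lemma cross_sign_swap:
  assumes "finite S" "finite T" "S \<inter> T = {}"
  shows "cross_sign T S = (-1) ^ (card S * card T) * (cross_sign S T :: 'a::comm_ring_1)"
  using assms(2,3)
proof (induction T rule: finite_induct)
  case (insert a T)
  then have "a \<notin> S" by auto
  then show ?case using insert assms(1)
    by (simp add: cross_sign_insert_left cross_sign_insert_right power_add mult_ac flip: power_mult_distrib)
qed (simp add: cross_sign_def)

text \<open>The factor \<open>tri_sign (card T)\<close> compensates \<open>cross_sign\<close>: apart
  from factors \<open>inv_sign i j\<close>, taking an index \<open>i\<close> out of \<open>T\<close>
  then costs a sign that depends only on the total number of indices.\<close>

definition split_weight :: "('b::linorder \<Rightarrow> 'a::field) \<Rightarrow> 'b set \<Rightarrow> 'b set \<Rightarrow> 'a" where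
  "split_weight x S T = tri_sign (card T) * cross_sign S T * omega x S * omega x T"

text \<open>Swapping the blocks produces \<open>(-1) ^ (s * t)\<close>, which
  \<open>tri_sign_add\<close> absorbs into \<open>tri_sign (card I)\<close>.\<close>

lemma split_weight_swap:
  fixes x :: "'b::linorder \<Rightarrow> 'a::field"
  assumes "finite I" "T \<subseteq> I"
  shows "split_weight x T (I - T) = tri_sign (card I) * split_weight x (I - T) T"
proof -
  have fin: "finite T" "finite (I - T)" using assms by (auto intro: finite_subset)
  define s t where "s = card (I - T)" and "t = card T"
  have card: "card I = s + t"
    using assms fin by (simp add: s_def t_def card_Diff_subset card_mono)
  have "cross_sign T (I - T) = (-1) ^ (s * t) * (cross_sign (I - T) T :: 'a)"
    using cross_sign_swap[OF fin(2,1)] by (auto simp: s_def t_def)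
  moreover have "tri_sign s * (-1) ^ (s * t) = tri_sign (card I) * (tri_sign t :: 'a)"
    by (simp add: card tri_sign_add mult_ac)
  ultimately show ?thesis
    by (simp add: split_weight_def mult_ac flip: s_def t_def)
qed

lemma sum_split_weight_swap:
  assumes "finite I"
  shows "(\<Sum>T\<in>Pow I. split_weight x (I - T) T * h T (I - T)) =
    tri_sign (card I) * (\<Sum>T\<in>Pow I. split_weight x (I - T) T * h (I - T) T)"
proof -
  have "(\<Sum>T\<in>Pow I. split_weight x (I - T) T * h T (I - T)) =
    (\<Sum>T\<in>Pow I. split_weight x T (I - T) * h (I - T) T)"
    by (rule sum.reindex_bij_witness[where i="\<lambda>T. I - T" and j="\<lambda>T. I - T"])
       (auto simp: double_diff)
  also have "\<dots> = (\<Sum>T\<in>Pow I. tri_sign (card I) * (split_weight x (I - T) T * h (I - T) T))"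
    using assms by (intro sum.cong) (auto simp: split_weight_swap)
  finally show ?thesis by (simp add: sum_distrib_left)
qed

lemma sum_Pow_remove:
  assumes "finite I"
  shows "(\<Sum>T\<in>Pow I. \<Sum>i\<in>T. g i T) = (\<Sum>i\<in>I. \<Sum>T\<in>Pow (I - {i}). g i (insert i T))"
proof -
  have "(\<Sum>T\<in>Pow I. \<Sum>i\<in>T. g i T) = (\<Sum>(T, i)\<in>Sigma (Pow I) (\<lambda>T. T). g i T)"
    using assms by (subst sum.Sigma) (auto intro: finite_subset)
  also have "\<dots> = (\<Sum>(i, T)\<in>Sigma I (\<lambda>i. Pow (I - {i})). g i (insert i T))"
    by (rule sum.reindex_bij_witness[where j="\<lambda>(T, i). (i, T - {i})" and i="\<lambda>(i, T). (insert i T, i)"])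
       (auto simp: insert_absorb)
  also have "\<dots> = (\<Sum>i\<in>I. \<Sum>T\<in>Pow (I - {i}). g i (insert i T))"
    using assms by (subst sum.Sigma) auto
  finally show ?thesis .
qed

text \<open>Summing over \<open>i\<close> first fixes the removed index. The set
  \<open>I - T\<close>, and with it \<open>h\<close>, is unaffected, and the signs from
  \<open>tri_sign\<close> and \<open>cross_sign\<close> combine to \<open>(-1) ^ card I\<close>, so
  the inner sum is again a sum over splittings, now of \<open>I - {i}\<close>.\<close>

lemma sum_split_remove:
  fixes x :: "'b::linorder \<Rightarrow> 'a::field"
  assumes "finite I"
  shows "(\<Sum>T\<in>Pow I. tri_sign (card T) * cross_sign (I - T) T * omega x (I - T) *
        (\<Sum>i\<in>T. y i * (\<Prod>j\<in>T-{i}. inv_sign i j) * omega x (T - {i})) * h (I - T)) =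
    (-1) ^ card I * (\<Sum>i\<in>I. y i * (\<Prod>j\<in>I-{i}. inv_sign i j) *
        (\<Sum>T\<in>Pow (I - {i}). split_weight x (I - {i} - T) T * h (I - {i} - T)))"
proof -
  have "(\<Sum>T\<in>Pow I. tri_sign (card T) * cross_sign (I - T) T * omega x (I - T) *
        (\<Sum>i\<in>T. y i * (\<Prod>j\<in>T-{i}. inv_sign i j) * omega x (T - {i})) * h (I - T)) =
     (\<Sum>T\<in>Pow I. \<Sum>i\<in>T. tri_sign (card T) * cross_sign (I - T) T * omega x (I - T) *
        (y i * (\<Prod>j\<in>T-{i}. inv_sign i j) * omega x (T - {i})) * h (I - T))"
    by (simp add: sum_distrib_left sum_distrib_right)
  also have "\<dots> = (\<Sum>i\<in>I. \<Sum>T\<in>Pow (I - {i}). (-1) ^ card I *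
       (y i * (\<Prod>j\<in>I-{i}. inv_sign i j) * (split_weight x (I - {i} - T) T * h (I - {i} - T))))"
    unfolding sum_Pow_remove[OF assms]
  proof (intro sum.cong refl)
    fix i T assume i: "i \<in> I" and "T \<in> Pow (I - {i})"
    then have T: "T \<subseteq> I - {i}" "i \<notin> T" "finite T" using assms by (auto intro: finite_subset)
    define S where "S = I - {i} - T"
    have S: "I - insert i T = S" "i \<notin> S" "finite S" using assms by (auto simp: S_def)
    have I: "I - {i} = S \<union> T" "S \<inter> T = {}" using T by (auto simp: S_def)
    have "card I = Suc (card (S \<union> T))" using card_Suc_Diff1[OF assms i] by (simp flip: I(1))
    then have card: "card I = Suc (card S + card T)" using S T I by (simp add: card_Un_disjoint)
    have prod: "(\<Prod>j\<in>I-{i}. inv_sign i j) = (\<Prod>j\<in>S. inv_sign i j) * (\<Prod>j\<in>T. inv_sign i j :: 'a)"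
      using S T I by (simp add: prod.union_disjoint)
    have "insert i T - {i} = T" using T by auto
    then show "tri_sign (card (insert i T)) * cross_sign (I - insert i T) (insert i T) * omega x (I - insert i T) *
        (y i * (\<Prod>j\<in>insert i T-{i}. inv_sign i j) * omega x (insert i T - {i})) * h (I - insert i T) =
      (-1) ^ card I * (y i * (\<Prod>j\<in>I-{i}. inv_sign i j) * (split_weight x (I - {i} - T) T * h (I - {i} - T)))"
      using S T unfolding S(1) S_def[symmetric] prod card
      by (simp add: cross_sign_insert_right split_weight_def power_add mult_ac)
  qed
  also have "\<dots> = (-1) ^ card I * (\<Sum>i\<in>I. y i * (\<Prod>j\<in>I-{i}. inv_sign i j) *
        (\<Sum>T\<in>Pow (I - {i}). split_weight x (I - {i} - T) T * h (I - {i} - T)))"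
    by (simp add: sum_distrib_left)
  finally show ?thesis .
qed

text \<open>The product on the left is the one in the residue weight for poles \<open>x j\<close>
  and zeros \<open>- x j\<close>; up to sign it cancels every factor of \<open>omega x I\<close>
  that involves \<open>i\<close>.\<close>

lemma omega_remove:
  fixes x :: "'b::linorder \<Rightarrow> 'a::field"
  assumes "finite I" "i \<in> I" "inj_on x I" "\<And>i j. i \<in> I \<Longrightarrow> j \<in> I \<Longrightarrow> i \<noteq> j \<Longrightarrow> x i + x j \<noteq> 0"
  shows "(\<Prod>j\<in>I-{i}. (x i + x j) / (x i - x j)) * omega x I = (\<Prod>j\<in>I-{i}. inv_sign i j) * omega x (I - {i})"
proof -
  have "omega x I = (\<Prod>j\<in>I-{i}. inv_sign i j) * (\<Prod>j\<in>I-{i}. (x i - x j) / (x i + x j)) * omega x (I - {i})"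
    using omega_insert[of "I - {i}" i x] assms(1,2) by (simp add: insert_absorb)
  moreover have "(\<Prod>j\<in>I-{i}. (x i + x j) / (x i - x j)) * (\<Prod>j\<in>I-{i}. (x i - x j) / (x i + x j)) = 1"
    unfolding prod.distrib[symmetric]
  proof (rule prod.neutral, rule ballI)
    fix j assume "j \<in> I - {i}"
    then have "x i + x j \<noteq> 0" "x i - x j \<noteq> 0" using assms(2-4) by (auto dest: inj_onD)
    then show "(x i + x j) / (x i - x j) * ((x i - x j) / (x i + x j)) = 1" by simp
  qed
  ultimately show ?thesis by (simp add: mult_ac)
qed

text \<open>The first partial fraction identity for \<open>u = x\<close> and \<open>v = - x\<close>,
  multiplied by \<open>omega x I\<close>; the differences \<open>u i - v i = 2 * x i\<close> bring
  in a factor 2 to cancel.\<close>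

lemma sum_mult_omega:
  fixes x :: "'b::linorder \<Rightarrow> 'a::field"
  assumes two: "(2::'a) \<noteq> 0" and "finite I" "inj_on x I"
    and "\<And>i j. i \<in> I \<Longrightarrow> j \<in> I \<Longrightarrow> i \<noteq> j \<Longrightarrow> x i + x j \<noteq> 0"
  shows "sum x I * omega x I = (\<Sum>i\<in>I. x i * (\<Prod>j\<in>I-{i}. inv_sign i j) * omega x (I - {i}))"
proof -
  have "2 * (\<Sum>i\<in>I. x i * (\<Prod>j\<in>I-{i}. (x i + x j) / (x i - x j))) = 2 * sum x I"
    using partial_fraction_weights(1)[OF assms(2,3), of "\<lambda>i. - x i"]
    by (simp add: sum_distrib_left flip: mult_2) (simp only: mult.assoc)
  then have "sum x I * omega x I = (\<Sum>i\<in>I. x i * (\<Prod>j\<in>I-{i}. (x i + x j) / (x i - x j))) * omega x I"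
    using two by simp
  also have "\<dots> = (\<Sum>i\<in>I. x i * ((\<Prod>j\<in>I-{i}. (x i + x j) / (x i - x j)) * omega x I))"
    by (simp add: sum_distrib_right mult.assoc)
  also have "\<dots> = (\<Sum>i\<in>I. x i * ((\<Prod>j\<in>I-{i}. inv_sign i j) * omega x (I - {i})))"
    using omega_remove[OF assms(2) _ assms(3,4)] by simp
  finally show ?thesis by (simp add: mult.assoc)
qed

text \<open>The partial fraction expansion for the same data at \<open>z\<close>, which will be the
  value of an index split off from the set.\<close>

lemma prod_mult_omega:
  fixes x :: "'b::linorder \<Rightarrow> 'a::field"
  assumes "finite I" "inj_on x I" "z \<notin> x ` I"
    and "\<And>i j. i \<in> I \<Longrightarrow> j \<in> I \<Longrightarrow> i \<noteq> j \<Longrightarrow> x i + x j \<noteq> 0"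
  shows "(\<Prod>j\<in>I. (z + x j) / (z - x j)) * omega x I =
    omega x I + (\<Sum>i\<in>I. 2 * x i / (z - x i) * (\<Prod>j\<in>I-{i}. inv_sign i j) * omega x (I - {i}))"
proof -
  have "(\<Prod>j\<in>I. (z + x j) / (z - x j)) * omega x I =
    omega x I + (\<Sum>i\<in>I. 2 * x i / (z - x i) * ((\<Prod>j\<in>I-{i}. (x i + x j) / (x i - x j)) * omega x I))"
    using partial_fraction_weights(2)[OF assms(1-3), of "\<lambda>i. - x i"]
    by (simp add: distrib_left distrib_right sum_distrib_left sum_distrib_right mult_ac flip: mult_2)
  also have "(\<Sum>i\<in>I. 2 * x i / (z - x i) * ((\<Prod>j\<in>I-{i}. (x i + x j) / (x i - x j)) * omega x I)) =
    (\<Sum>i\<in>I. 2 * x i / (z - x i) * ((\<Prod>j\<in>I-{i}. inv_sign i j) * omega x (I - {i})))"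
    using omega_remove[OF assms(1) _ assms(2,4)] by simp
  finally show ?thesis by (simp add: mult.assoc)
qed

section \<open>Recurrence and initial value of the signed sums\<close>

definition subset_sum_form :: "('b::linorder \<Rightarrow> 'a::field) \<Rightarrow> ('a \<Rightarrow> 'a) \<Rightarrow> 'b set \<Rightarrow> 'a" where
  "subset_sum_form x f I = (\<Sum>T\<in>Pow I. split_weight x (I - T) T * f (sum x (I - T)))"

text \<open>With \<open>s = sum x (I - T)\<close>, the difference
  \<open>sum x I * s ^ n - s ^ Suc n\<close> is \<open>sum x T * s ^ n\<close>. The factor
  \<open>sum x T\<close> is absorbed into \<open>omega x T\<close> by \<open>sum_mult_omega\<close>,
  which removes one index from \<open>T\<close>.\<close>

lemma subset_sum_form_power_Suc:
  fixes x :: "'b::linorder \<Rightarrow> 'a::field"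
  assumes two: "(2::'a) \<noteq> 0" and fin: "finite I" and inj: "inj_on x I"
    and nz: "\<And>i j. i \<in> I \<Longrightarrow> j \<in> I \<Longrightarrow> i \<noteq> j \<Longrightarrow> x i + x j \<noteq> 0"
  shows "subset_sum_form x (\<lambda>s. s ^ Suc n) I = sum x I * subset_sum_form x (\<lambda>s. s ^ n) I -
    (-1) ^ card I * (\<Sum>i\<in>I. x i * (\<Prod>j\<in>I-{i}. inv_sign i j) * subset_sum_form x (\<lambda>s. s ^ n) (I - {i}))"
proof -
  have "sum x I * subset_sum_form x (\<lambda>s. s ^ n) I - subset_sum_form x (\<lambda>s. s ^ Suc n) I =
    (\<Sum>T\<in>Pow I. tri_sign (card T) * cross_sign (I - T) T * omega x (I - T) *
        (sum x T * omega x T) * sum x (I - T) ^ n)"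
    unfolding subset_sum_form_def sum_distrib_left sum_subtractf[symmetric]
  proof (rule sum.cong[OF refl])
    fix T assume "T \<in> Pow I"
    then have "sum x I = sum x T + sum x (I - T)" 
      using fin by (metis PowD sum.subset_diff add.commute)
    then show "sum x I * (split_weight x (I - T) T * sum x (I - T) ^ n) - split_weight x (I - T) T * sum x (I - T) ^ Suc n =
      tri_sign (card T) * cross_sign (I - T) T * omega x (I - T) * (sum x T * omega x T) * sum x (I - T) ^ n"
      by (simp add: split_weight_def algebra_simps)
  qed
  also have "\<dots> = (\<Sum>T\<in>Pow I. tri_sign (card T) * cross_sign (I - T) T * omega x (I - T) *
        (\<Sum>i\<in>T. x i * (\<Prod>j\<in>T-{i}. inv_sign i j) * omega x (T - {i})) * sum x (I - T) ^ n)"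
  proof (rule sum.cong[OF refl])
    fix T assume "T \<in> Pow I"
    then have T: "finite T" "T \<subseteq> I" using fin by (auto intro: finite_subset)
    then have "inj_on x T" using inj inj_on_subset by blast
    from sum_mult_omega[OF two T(1) this] nz T(2)
    show "tri_sign (card T) * cross_sign (I - T) T * omega x (I - T) * (sum x T * omega x T) * sum x (I - T) ^ n =
      tri_sign (card T) * cross_sign (I - T) T * omega x (I - T) *
        (\<Sum>i\<in>T. x i * (\<Prod>j\<in>T-{i}. inv_sign i j) * omega x (T - {i})) * sum x (I - T) ^ n"
      by (simp add: subset_iff)
  qed
  also have "\<dots> = (-1) ^ card I * (\<Sum>i\<in>I. x i * (\<Prod>j\<in>I-{i}. inv_sign i j) * subset_sum_form x (\<lambda>s. s ^ n) (I - {i}))"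
    unfolding subset_sum_form_def by (rule sum_split_remove[OF fin, where h="\<lambda>S. sum x S ^ n"])
  finally show ?thesis by (simp add: algebra_simps)
qed

lemma sum_Pow_insert:
  assumes "finite J" "a \<notin> J"
  shows "(\<Sum>T\<in>Pow (insert a J). g T) = (\<Sum>T\<in>Pow J. g T + g (insert a T))"
proof -
  have "(\<Sum>T\<in>insert a ` Pow J. g T) = (\<Sum>T\<in>Pow J. g (insert a T))"
    using assms by (subst sum.reindex) (auto simp: inj_on_def)
  moreover have "Pow J \<inter> insert a ` Pow J = {}" using assms by auto
  ultimately show ?thesis
    using assms by (simp add: Pow_insert sum.union_disjoint sum.distrib)
qed

text \<open>Initial value of the recurrence. For one or two indices, complementing \<open>T\<close>
  changes the sign of the sum. For more, an index \<open>a\<close> is split off: its two positions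
  give multiples of sums \<open>Z\<close> and \<open>Z'\<close> over the other indices, and both
  vanish.\<close>

lemma subset_sum_form_1:
  fixes x :: "'b::linorder \<Rightarrow> 'a::field"
  assumes two: "(2::'a) \<noteq> 0" and "finite I" "I \<noteq> {}" "inj_on x I"
    and "\<And>i j. i \<in> I \<Longrightarrow> j \<in> I \<Longrightarrow> i \<noteq> j \<Longrightarrow> x i + x j \<noteq> 0"
  shows "subset_sum_form x (\<lambda>_. 1) I = 0"
  using assms(2-)
proof (induction "card I" arbitrary: I rule: less_induct)
  case less
  note fin = less.prems(1) and inj = less.prems(3) and nz = less.prems(4)
  have IH: "subset_sum_form x (\<lambda>_. 1) J = 0" if "J \<subset> I" "J \<noteq> {}" for J
    using that fin inj nz
    by (intro less.hyps) (auto intro: psubset_card_mono finite_subset inj_on_subset)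
  show ?case
  proof (cases "card I \<le> 2")
    case True
    moreover have "card I \<noteq> 0" using less.prems by auto
    ultimately have "card I = Suc 0 \<or> card I = Suc (Suc 0)" by linarith
    then have "tri_sign (card I) = (-1 :: 'a)" by auto
    then have "subset_sum_form x (\<lambda>_. 1) I = - subset_sum_form x (\<lambda>_. 1) I"
      using sum_split_weight_swap[OF fin, of x "\<lambda>_ _. 1"] by (simp add: subset_sum_form_def)
    then have "2 * subset_sum_form x (\<lambda>_. 1) I = 0" by (simp add: eq_neg_iff_add_eq_0)
    then show ?thesis using two by simp
  next
    case False
    obtain a where a: "a \<in> I" using less.prems by auto
    define J where "J = I - {a}"
    have I: "I = insert a J" and J: "a \<notin> J" "finite J" using a fin by (auto simp: J_def)
    \<comment> \<open>With two further indices, both \<open>J\<close> and each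
      \<open>J - {i}\<close> are nonempty and fall under the induction hypothesis.\<close>
    have card: "card J \<ge> 2" using False I J by auto
    have xa: "x a \<notin> x ` J" using inj J by (auto simp: I)
    have injJ: "inj_on x J" using inj I by auto
    \<comment> \<open>Up to sign, \<open>k T\<close> is what \<open>omega\<close> gains when
      \<open>a\<close> joins \<open>T\<close>. As \<open>r\<close> inverts \<open>k\<close>,
      \<open>k (J - T)\<close> becomes \<open>k J * r T\<close>, whose first factor is free of
      \<open>T\<close>.\<close>
    define r where "r = (\<lambda>T. \<Prod>j\<in>T. (x a + x j) / (x a - x j))"
    define k where "k = (\<lambda>T. \<Prod>j\<in>T. (x a - x j) / (x a + x j))"
    define s where "s = (\<lambda>T. \<Prod>j\<in>T. inv_sign a j :: 'a)"
    have kr: "k T * r T = 1" if "T \<subseteq> J" for T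
      unfolding k_def r_def prod.distrib[symmetric]
    proof (rule prod.neutral, rule ballI)
      fix j assume "j \<in> T"
      then have "x a + x j \<noteq> 0" "x a - x j \<noteq> 0" using that nz[of a j] I J xa by auto
      then show "(x a - x j) / (x a + x j) * ((x a + x j) / (x a - x j)) = 1" by simp
    qed
    have split: "k J = k T * k (J - T)" "s J = s T * s (J - T)" if "T \<subseteq> J" for T
      using prod.subset_diff[OF that J(2)] by (auto simp: k_def s_def mult.commute)
    \<comment> \<open>\<open>split_weight_swap\<close> only settles the sizes \<open>1\<close> and \<open>2\<close> modulo \<open>4\<close>; expanding \<open>r T\<close> in
      partial fractions reduces \<open>Z\<close> to index sets smaller by one or two.\<close>
    define Z where "Z = (\<Sum>T\<in>Pow J. split_weight x (J - T) T * r T)"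
    define Z' where "Z' = (\<Sum>T\<in>Pow J. split_weight x (J - T) T * r (J - T))"
    have "Z = (\<Sum>T\<in>Pow J. tri_sign (card T) * cross_sign (J - T) T * omega x (J - T) * (r T * omega x T))"
      unfolding Z_def by (simp add: split_weight_def mult_ac)
    also have "\<dots> = (\<Sum>T\<in>Pow J. split_weight x (J - T) T * 1 + tri_sign (card T) * cross_sign (J - T) T * omega x (J - T) *
      (\<Sum>i\<in>T. 2 * x i / (x a - x i) * (\<Prod>j\<in>T-{i}. inv_sign i j) * omega x (T - {i})) * 1)"
    proof (rule sum.cong[OF refl])
      fix T assume "T \<in> Pow J"
      then have T: "finite T" "T \<subseteq> J" using J by (auto intro: finite_subset)
      have *: "inj_on x T" "x a \<notin> x ` T" using T xa injJ by (auto intro: inj_on_subset)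
      have "r T * omega x T = omega x T + (\<Sum>i\<in>T. 2 * x i / (x a - x i) * (\<Prod>j\<in>T-{i}. inv_sign i j) * omega x (T - {i}))"
        unfolding r_def using T I nz by (intro prod_mult_omega *) auto
      then show "tri_sign (card T) * cross_sign (J - T) T * omega x (J - T) * (r T * omega x T) =
         split_weight x (J - T) T * 1 + tri_sign (card T) * cross_sign (J - T) T * omega x (J - T) *
         (\<Sum>i\<in>T. 2 * x i / (x a - x i) * (\<Prod>j\<in>T-{i}. inv_sign i j) * omega x (T - {i})) * 1"
        by (simp add: split_weight_def ring_distribs)
    qed
    also have "\<dots> = subset_sum_form x (\<lambda>_. 1) J + (-1) ^ card J * (\<Sum>i\<in>J. 2 * x i / (x a - x i) *
        (\<Prod>j\<in>J-{i}. inv_sign i j) * subset_sum_form x (\<lambda>_. 1) (J - {i}))"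
      unfolding sum.distrib subset_sum_form_def sum_split_remove[OF J(2), where h="\<lambda>_. 1"] ..
    also have "\<dots> = 0"
    proof -
      have "J \<noteq> {}" using card by auto
      moreover have "J - {i} \<noteq> {}" if "i \<in> J" for i
      proof
        assume "J - {i} = {}"
        then have "J = {i}" using that by auto
        then show False using card by simp
      qed
      moreover have "J \<subset> I" using I J by auto
      moreover from this have "J - {i} \<subset> I" for i by auto
      ultimately show ?thesis by (simp add: IH)
    qed
    finally have Z: "Z = 0" .
    have Z': "Z' = 0"
      using sum_split_weight_swap[OF J(2), of x "\<lambda>S T. r T"] Z by (simp add: Z_def Z'_def)
    have "subset_sum_form x (\<lambda>_. 1) I = (\<Sum>T\<in>Pow J. split_weight x (I - T) T + split_weight x (I - insert a T) (insert a T))"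
      unfolding subset_sum_form_def using sum_Pow_insert[OF J(2,1)] by (simp flip: I)
    also have "\<dots> = (\<Sum>T\<in>Pow J. s J * k J * (split_weight x (J - T) T * r T) -
       (-1) ^ card J * s J * k J * (split_weight x (J - T) T * r (J - T)))"
    proof (rule sum.cong[OF refl])
      fix T assume "T \<in> Pow J"
      then have T: "finite T" "T \<subseteq> J" "a \<notin> T" using J by (auto intro: finite_subset)
      define S where "S = J - T"
      have S: "finite S" "a \<notin> S" "I - T = insert a S" "I - insert a T = S" "S \<subseteq> J"
        using T J I by (auto simp: S_def)
      have "card J = card S + card T" using T J by (simp add: S_def card_Diff_subset card_mono)
      then have cd: "(-1) ^ card J = (-1) ^ card S * (-1 :: 'a) ^ card T" by (simp add: power_add)
      have kk: "k J * r T = k S" "k J * r S = k T"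
        using split[OF T(2)] kr[OF T(2)] kr[OF S(5)] by (simp_all add: S_def mult_ac)
      have ss: "s J = s T * s S" using split[OF T(2)] by (simp add: S_def)
      have 1: "split_weight x (insert a S) T = s J * k S * split_weight x S T"
        using S T unfolding ss unfolding k_def s_def
        by (simp add: split_weight_def cross_sign_insert_left omega_insert mult_ac)
      have 2: "split_weight x S (insert a T) = - ((-1) ^ card J * s J * k T * split_weight x S T)"
        using S T unfolding ss cd unfolding k_def s_def
        by (simp add: split_weight_def cross_sign_insert_right omega_insert mult_ac)
      show "split_weight x (I - T) T + split_weight x (I - insert a T) (insert a T) =
         s J * k J * (split_weight x (J - T) T * r T) - (-1) ^ card J * s J * k J * (split_weight x (J - T) T * r (J - T))"
        unfolding S(3,4) 1 2 S_def[symmetric] kk[symmetric] by (simp add: mult_ac)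
    qed
    also have "\<dots> = s J * k J * Z - (-1) ^ card J * s J * k J * Z'"
      by (simp add: sum_subtractf Z_def Z'_def sum_distrib_left)
    finally show ?thesis by (simp add: Z Z')
  qed
qed

section \<open>The polynomial side\<close>

text \<open>The first hypothesis says that the characteristic is 0 or exceeds \<open>m\<close>; it
  recurs below in this form.\<close>

lemma of_nat_eq_imp_eq:
  assumes "\<And>k. 0 < k \<Longrightarrow> k \<le> m \<Longrightarrow> of_nat k \<noteq> (0::'a::ring_1)"
    and "a \<le> m" "b \<le> m" "of_nat a = (of_nat b :: 'a)"
  shows "a = b"
  using assms(2-4)
proof (induction a b rule: linorder_wlog)
  case (le a b)
  show ?case
  proof (rule ccontr)
    assume "a \<noteq> b"
    then have "of_nat (b - a) \<noteq> (0::'a)" using le by (intro assms(1)) auto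
    then show False using le by (simp add: of_nat_diff)
  qed
qed auto

text \<open>Forcing the value 0 outside \<open>I\<close> keeps the set finite for finite
  \<open>I\<close>, and lowering an entry from 1 to 0 at \<open>i\<close> lands in
  \<open>exponents (I - {i})\<close>.\<close>

definition exponents :: "'b set \<Rightarrow> nat \<Rightarrow> ('b \<Rightarrow> nat) set" where
  "exponents I n = {l. (\<forall>i. 0 < l i \<longleftrightarrow> i \<in> I) \<and> sum l I = n}"

lemma finite_exponents:
  assumes "finite I"
  shows "finite (exponents I n)"
proof (rule finite_subset)
  show "exponents I n \<subseteq> {l. \<forall>i. (i \<in> I \<longrightarrow> l i \<in> {..n}) \<and> (i \<notin> I \<longrightarrow> l i = 0)}"
    using assms by (auto simp: exponents_def intro: member_le_sum)
  show "finite {l. \<forall>i. (i \<in> I \<longrightarrow> l i \<in> {..n}) \<and> (i \<notin> I \<longrightarrow> l i = (0::nat))}"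
    using assms by (intro finite_set_of_finite_funs) auto
qed

text \<open>In characteristic 0, for \<open>l\<close> positive and strictly decreasing on a finite
  \<open>I\<close>, \<open>fact (sum l I) * coef l I\<close> is the number of shifted standard Young
  tableaux of shape \<open>l\<close>. The identity for lowered exponents below is their branching
  rule.\<close>

definition coef :: "('b::linorder \<Rightarrow> nat) \<Rightarrow> 'b set \<Rightarrow> 'a::field" where
  "coef l I = omega (\<lambda>i. of_nat (l i)) I / (\<Prod>i\<in>I. of_nat (fact (l i)))"

lemma prod_transpose:
  assumes "a \<in> I" "b \<in> I"
  shows "(\<Prod>i\<in>I. g (Transposition.transpose a b i)) = (\<Prod>i\<in>I. g i)"
  by (rule prod.reindex_bij_witness[where i="Transposition.transpose a b" and j="Transposition.transpose a b"])
     (use assms in \<open>auto simp: transpose_def\<close>)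

lemma coef_swap:
  assumes "finite I" "a \<in> I" "b \<in> I" "a \<noteq> b"
  shows "coef (l \<circ> Transposition.transpose a b) I = (- coef l I :: 'a::field)"
  using omega_swap[OF assms, of "\<lambda>i. of_nat (l i) :: 'a"]
    prod_transpose[OF assms(2,3), of "\<lambda>i. of_nat (fact (l i)) :: 'a"]
  by (simp add: coef_def comp_def)

lemma coef_eq_0:
  "finite I \<Longrightarrow> a \<in> I \<Longrightarrow> b \<in> I \<Longrightarrow> a \<noteq> b \<Longrightarrow> l a = l b \<Longrightarrow> coef l I = 0"
  by (simp add: coef_def omega_eq_0)

lemma exponents_add_le:
  assumes "l \<in> exponents I n" "finite I" "i \<in> I" "j \<in> I" "i \<noteq> j"
  shows "l i + l j \<le> n"
proof -
  have "l i + l j = sum l {i, j}" using assms by simp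
  also have "\<dots> \<le> sum l I" using assms by (intro sum_mono2) auto
  finally show ?thesis using assms by (simp add: exponents_def)
qed

text \<open>The substitution \<open>u = y (y - 1)\<close>, \<open>v = y (y + 1)\<close> turns this into the partial fraction
  identity. An exponent lowered to \<open>0\<close> causes no harm, since all the others stay positive.\<close>

lemma sum_coef_decrement:
  fixes l :: "'b::linorder \<Rightarrow> nat"
  assumes two: "(2::'a::field) \<noteq> 0" and fin: "finite I" and l: "l \<in> exponents I n"
    and char: "\<And>k. 0 < k \<Longrightarrow> k \<le> n \<Longrightarrow> of_nat k \<noteq> (0::'a)"
  shows "(\<Sum>i\<in>I. coef (l(i := l i - 1)) I) = (of_nat n * coef l I :: 'a)"
proof (cases "inj_on l I")
  case True
  define y where "y = (\<lambda>i. of_nat (l i) :: 'a)"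
  define u where "u = (\<lambda>i. y i * (y i - 1))"
  define v where "v = (\<lambda>i. y i * (y i + 1))"
  have pos: "l i > 0" "l i \<le> n" if "i \<in> I" for i
    using l that fin by (auto simp: exponents_def intro: member_le_sum)
  have y0: "y i \<noteq> 0" if "i \<in> I" for i using char[of "l i"] pos[OF that] by (simp add: y_def)
  have ne: "y i + y j \<noteq> 0" "y i - 1 + y j \<noteq> 0" "y i - y j \<noteq> 0" if "i \<in> I" "j \<in> I" "i \<noteq> j" for i j
  proof -
    have le: "l i + l j \<le> n" using exponents_add_le[OF l fin that] .
    show "y i + y j \<noteq> 0" using char[of "l i + l j"] le pos[OF that(1)] by (simp add: y_def)
    \<comment> \<open>This is a denominator after \<open>l i\<close> is lowered; both entries being
      positive keeps it above 0.\<close>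
    have "y i - 1 + y j = of_nat (l i + l j - 1)"
      using pos[OF that(1)] by (simp add: y_def of_nat_diff)
    moreover have "0 < l i + l j - 1" "l i + l j - 1 \<le> n"
      using le pos[OF that(1)] pos[OF that(2)] by linarith+
    ultimately show "y i - 1 + y j \<noteq> 0" using char[of "l i + l j - 1"] by (simp only: not_False_eq_True)
    show "y i - y j \<noteq> 0"
      using of_nat_eq_imp_eq[OF char, of n "l i" "l j"] pos that True by (auto simp: y_def inj_on_def)
  qed
  \<comment> \<open>\<open>u i - u j\<close> is the new denominator times the old numerator,
    \<open>u i - v j\<close> the new numerator times the old denominator; their quotient turns the
    old factor of \<open>omega\<close> into the lowered one.\<close>
  have uu: "u i - u j = (y i - 1 + y j) * (y i - y j)" for i j by (simp add: u_def algebra_simps)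
  have uv: "u i - v j = (y i - 1 - y j) * (y i + y j)" for i j by (simp add: u_def v_def algebra_simps)
  have uv_same: "u i - v i = -2 * y i" for i by (simp add: u_def v_def algebra_simps)
  have "inj_on u I"
  proof (rule inj_onI, rule ccontr)
    fix i j assume *: "i \<in> I" "j \<in> I" "u i = u j" "i \<noteq> j"
    then have "(y i - 1 + y j) * (y i - y j) = 0" using uu[of i j] by simp
    then show False using ne[OF *(1,2,4)] by simp
  qed
  from partial_fraction_weights(1)[OF fin this, of v]
  have "(\<Sum>i\<in>I. -2 * y i * (\<Prod>j\<in>I-{i}. (u i - v j) / (u i - u j))) = (\<Sum>i\<in>I. -2 * y i)"
    unfolding uv_same .
  then have "-2 * (\<Sum>i\<in>I. y i * (\<Prod>j\<in>I-{i}. (u i - v j) / (u i - u j))) = -2 * (\<Sum>i\<in>I. y i)"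
    by (simp only: sum_distrib_left mult.assoc)
  then have pf: "(\<Sum>i\<in>I. y i * (\<Prod>j\<in>I-{i}. (u i - v j) / (u i - u j))) = (\<Sum>i\<in>I. y i)"
    using two by simp
  have step: "coef (l(i := l i - 1)) I = coef l I * (y i * (\<Prod>j\<in>I-{i}. (u i - v j) / (u i - u j)))" if i: "i \<in> I" for i
  proof -
    have I: "I = insert i (I - {i})" using i by auto
    define l' where "l' = l(i := l i - 1)"
    define s where "s = (\<Prod>j\<in>I-{i}. inv_sign i j :: 'a)"
    have l': "of_nat (l' i) = y i - 1" "\<And>j. j \<in> I - {i} \<Longrightarrow> of_nat (l' j) = y j"
      using pos[OF i] by (auto simp: l'_def y_def of_nat_diff)
    have o: "omega y I = s * (\<Prod>j\<in>I-{i}. (y i - y j) / (y i + y j)) * omega y (I - {i})"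
      by (subst I, subst omega_insert) (use fin in \<open>auto simp: s_def\<close>)
    have "omega (\<lambda>i. of_nat (l' i)) (I - {i}) = omega y (I - {i})"
      using l'(2) by (rule omega_cong)
    then have "omega (\<lambda>i. of_nat (l' i)) I = s * (\<Prod>j\<in>I-{i}. (y i - 1 - y j) / (y i - 1 + y j)) * omega y (I - {i})"
      by (subst I, subst omega_insert) (use fin l' in \<open>auto simp: s_def\<close>)
    also have "(\<Prod>j\<in>I-{i}. (y i - 1 - y j) / (y i - 1 + y j)) =
      (\<Prod>j\<in>I-{i}. (y i - y j) / (y i + y j) * ((u i - v j) / (u i - u j)))"
    proof (rule prod.cong[OF refl])
      fix j assume "j \<in> I - {i}"
      then have "y i + y j \<noteq> 0" "y i - 1 + y j \<noteq> 0" "y i - y j \<noteq> 0" using ne[of i j] i by auto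
      then show "(y i - 1 - y j) / (y i - 1 + y j) = (y i - y j) / (y i + y j) * ((u i - v j) / (u i - u j))"
        unfolding uu uv by simp
    qed
    finally have 1: "omega (\<lambda>i. of_nat (l' i)) I = omega y I * (\<Prod>j\<in>I-{i}. (u i - v j) / (u i - u j))"
      unfolding prod.distrib o by (simp add: mult_ac)
    have f: "fact (l i) = l i * fact (l i - 1)" using pos[OF i] by (simp add: fact_reduce)
    have "(\<Prod>j\<in>I. of_nat (fact (l j))) = of_nat (fact (l i)) * (\<Prod>j\<in>I-{i}. of_nat (fact (l j)) :: 'a)"
      using fin i by (rule prod.remove)
    also have "\<dots> = y i * (of_nat (fact (l' i)) * (\<Prod>j\<in>I-{i}. of_nat (fact (l' j))))"
      by (subst f) (simp add: y_def l'_def)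
    also have "of_nat (fact (l' i)) * (\<Prod>j\<in>I-{i}. of_nat (fact (l' j))) = (\<Prod>j\<in>I. of_nat (fact (l' j)) :: 'a)"
      using fin i by (rule prod.remove[symmetric])
    finally show ?thesis
      unfolding coef_def l'_def[symmetric] 1 using y0[OF i] by (simp flip: y_def)
  qed
  have "(\<Sum>i\<in>I. coef (l(i := l i - 1)) I) = coef l I * (\<Sum>i\<in>I. y i)"
    using step by (simp add: sum_distrib_left[symmetric] pf)
  also have "(\<Sum>i\<in>I. y i) = of_nat n"
    using l by (auto simp: exponents_def y_def)
  finally show ?thesis by (simp only: mult.commute)
next
  case False
  then obtain a b where ab: "a \<in> I" "b \<in> I" "a \<noteq> b" "l a = l b" by (auto simp: inj_on_def)
  define l' where "l' = l(b := l b - 1)"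
  have l': "l(a := l a - 1) = l' \<circ> Transposition.transpose a b"
    using ab by (auto simp: l'_def transpose_def fun_eq_iff)
  \<comment> \<open>Lowering any other entry keeps \<open>l a = l b\<close> and gives 0. Lowering at
    \<open>a\<close> and at \<open>b\<close> gives transposed vectors, which cancel by
    antisymmetry.\<close>
  have "(\<Sum>i\<in>I. coef (l(i := l i - 1)) I) = (\<Sum>i\<in>{a, b}. coef (l(i := l i - 1)) I :: 'a)"
    using ab fin by (intro sum.mono_neutral_right) (auto intro: coef_eq_0[where a=a and b=b])
  also have "\<dots> = coef (l(a := l a - 1)) I + coef l' I"
    using ab(3) unfolding l'_def by simp
  also have "\<dots> = 0"
    unfolding l' coef_swap[OF fin ab(1-3)] by simp
  also have "\<dots> = of_nat n * coef l I" using ab by (simp add: coef_eq_0[OF fin])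
  finally show ?thesis .
qed

text \<open>Lowering an entry above 1 at \<open>i\<close> keeps the support, lowering an entry 1
  takes \<open>i\<close> out of it; raising the entry at \<open>i\<close> inverts both
  cases.\<close>

lemma sum_exponents_decrement:
  assumes fin: "finite I" and i: "i \<in> I"
  shows "(\<Sum>l\<in>exponents I (Suc n). g (l(i := l i - 1))) =
    (\<Sum>l\<in>exponents I n. g l) + (\<Sum>l\<in>exponents (I - {i}) n. g l)"
proof -
  have disj: "exponents I n \<inter> exponents (I - {i}) n = {}"
    using i by (auto simp: exponents_def)
  have sum: "sum l I = l i + sum l (I - {i})" for l :: "'a \<Rightarrow> nat"
    using fin i by (rule sum.remove)
  have upd: "sum (l(i := c)) (I - {i}) = sum l (I - {i})" for l :: "'a \<Rightarrow> nat" and c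
    by (intro sum.cong) auto
  have "(\<Sum>l\<in>exponents I (Suc n). g (l(i := l i - 1))) = (\<Sum>l\<in>exponents I n \<union> exponents (I - {i}) n. g l)"
  proof (rule sum.reindex_bij_witness[where i="\<lambda>l. l(i := l i + 1)" and j="\<lambda>l. l(i := l i - 1)"])
    fix l assume l: "l \<in> exponents I (Suc n)"
    then have "l i > 0" using i by (simp add: exponents_def)
    then show "(l(i := l i - 1))(i := (l(i := l i - 1)) i + 1) = l" by auto
    show "l(i := l i - 1) \<in> exponents I n \<union> exponents (I - {i}) n"
    proof (cases "l i = 1")
      case True
      then show ?thesis using l i unfolding exponents_def by (auto simp: sum upd)
    next
      case False
      then have "l i - 1 > 0" using \<open>l i > 0\<close> by linarith
      then show ?thesis using l i unfolding exponents_def by (auto simp: sum upd)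
    qed
  next
    fix l assume l: "l \<in> exponents I n \<union> exponents (I - {i}) n"
    then have "l i + sum l (I - {i}) = n" by (auto simp: exponents_def sum)
    moreover have "0 < l j \<longleftrightarrow> j \<in> I" if "j \<noteq> i" for j
      using l that by (auto simp: exponents_def)
    ultimately show "l(i := l i + 1) \<in> exponents I (Suc n)"
      using i by (simp add: exponents_def sum upd)
  qed auto
  then show ?thesis
    using disj fin by (simp add: sum.union_disjoint finite_exponents)
qed

section \<open>Recurrence on the polynomial side\<close>

definition coef_form :: "('b::linorder \<Rightarrow> 'a::field) \<Rightarrow> nat \<Rightarrow> 'b set \<Rightarrow> 'a" where
  "coef_form x n I = of_nat (fact n) * (\<Sum>l\<in>exponents I n. coef l I * (\<Prod>i\<in>I. x i ^ l i))"

text \<open>The factor \<open>Suc n\<close> of the factorial is spent on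
  \<open>sum_coef_decrement\<close>, and each lowered monomial releases a factor \<open>x i\<close>.
  Lowered vectors still positive at \<open>i\<close> give the first term, those with entry 0 at
  \<open>i\<close> the terms for \<open>I - {i}\<close>.\<close>

lemma coef_form_Suc:
  fixes x :: "'b::linorder \<Rightarrow> 'a::field"
  assumes two: "(2::'a) \<noteq> 0" and fin: "finite I"
    and char: "\<And>k. 0 < k \<Longrightarrow> k \<le> Suc n \<Longrightarrow> of_nat k \<noteq> (0::'a)"
  shows "coef_form x (Suc n) I = sum x I * coef_form x n I -
    (-1) ^ card I * (\<Sum>i\<in>I. x i * (\<Prod>j\<in>I-{i}. inv_sign i j) * coef_form x n (I - {i}))"
proof -
  define mon where "mon = (\<lambda>l. \<Prod>i\<in>I. x i ^ l i)"
  have mon_eq: "(\<Prod>i\<in>I. x i ^ l i) = mon l" for l by (simp add: mon_def)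
  have mon: "mon l = x i * mon (l(i := l i - 1))" if "l \<in> exponents I (Suc n)" "i \<in> I" for l i
  proof -
    have "l i > 0" using that by (simp add: exponents_def)
    then have li: "x i ^ l i = x i * x i ^ (l i - 1)" by (cases "l i") auto
    have "(\<Prod>j\<in>I-{i}. x j ^ (l(i := l i - 1)) j) = (\<Prod>j\<in>I-{i}. x j ^ l j)"
      by (intro prod.cong) auto
    then show ?thesis
      unfolding mon_def prod.remove[OF fin that(2)] by (simp add: li)
  qed
  have sub: "(\<Sum>l\<in>exponents (I - {i}) n. coef l I * mon l) =
      - ((-1) ^ card I * (\<Prod>j\<in>I-{i}. inv_sign i j)) *
        (\<Sum>l\<in>exponents (I - {i}) n. coef l (I - {i}) * (\<Prod>j\<in>I-{i}. x j ^ l j))" if i: "i \<in> I" for i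
    unfolding sum_distrib_left
  proof (rule sum.cong[OF refl])
    fix l assume l: "l \<in> exponents (I - {i}) n"
    have I: "I = insert i (I - {i})" using i by auto
    have li: "l i = 0" using l by (auto simp: exponents_def)
    have m: "mon l = (\<Prod>j\<in>I-{i}. x j ^ l j)"
      unfolding mon_def prod.remove[OF fin i] by (simp add: li)
    have f: "(\<Prod>j\<in>I. of_nat (fact (l j))) = (\<Prod>j\<in>I-{i}. of_nat (fact (l j)) :: 'a)"
      unfolding prod.remove[OF fin i] by (simp add: li)
    \<comment> \<open>Each factor is \<open>(0 - l j) / (0 + l j) = -1\<close>, and there are
      \<open>card I - 1\<close> of them.\<close>
    have "(\<Prod>j\<in>I-{i}. (of_nat (l i) - of_nat (l j)) / (of_nat (l i) + of_nat (l j))) = (\<Prod>j\<in>I-{i}. - 1 :: 'a)"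
    proof (rule prod.cong[OF refl])
      fix j assume j: "j \<in> I - {i}"
      have "l j \<le> n" "0 < l j" using l j fin by (auto simp: exponents_def intro: member_le_sum)
      then show "(of_nat (l i) - of_nat (l j)) / (of_nat (l i) + of_nat (l j)) = (- 1 :: 'a)"
        using char[of "l j"] by (simp add: li)
    qed
    then have "(\<Prod>j\<in>I-{i}. (of_nat (l i) - of_nat (l j)) / (of_nat (l i) + of_nat (l j))) = - ((-1 :: 'a) ^ card I)"
      using card_Suc_Diff1[OF fin i, symmetric] by simp
    then have "omega (\<lambda>i. of_nat (l i)) I = - ((-1) ^ card I * (\<Prod>j\<in>I-{i}. inv_sign i j)) * (omega (\<lambda>i. of_nat (l i)) (I - {i}) :: 'a)"
      by (subst I, subst omega_insert) (use fin in auto)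
    then have "coef l I = - ((-1) ^ card I * (\<Prod>j\<in>I-{i}. inv_sign i j)) * (coef l (I - {i}) :: 'a)"
      unfolding coef_def f by simp
    then show "coef l I * mon l = - ((-1) ^ card I * (\<Prod>j\<in>I-{i}. inv_sign i j)) * (coef l (I - {i}) * (\<Prod>j\<in>I-{i}. x j ^ l j))"
      by (simp add: m)
  qed
  have "coef_form x (Suc n) I = of_nat (fact n) * (\<Sum>l\<in>exponents I (Suc n). (of_nat (Suc n) * coef l I) * mon l)"
    unfolding coef_form_def mon_eq
    by (simp only: fact_Suc of_nat_mult of_nat_id sum_distrib_left mult.assoc mult.commute mult.left_commute)
  also have "(\<Sum>l\<in>exponents I (Suc n). (of_nat (Suc n) * coef l I) * mon l) =
     (\<Sum>l\<in>exponents I (Suc n). \<Sum>i\<in>I. x i * (coef (l(i := l i - 1)) I * mon (l(i := l i - 1))))"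
  proof (rule sum.cong[OF refl])
    fix l assume l: "l \<in> exponents I (Suc n)"
    have "of_nat (Suc n) * coef l I * mon l = (\<Sum>i\<in>I. coef (l(i := l i - 1)) I * mon l)"
      unfolding sum_distrib_right[symmetric] by (subst sum_coef_decrement[OF two fin l char]) auto
    also have "\<dots> = (\<Sum>i\<in>I. x i * (coef (l(i := l i - 1)) I * mon (l(i := l i - 1))))"
      using mon[OF l] by (intro sum.cong) auto
    finally show "of_nat (Suc n) * coef l I * mon l = \<dots>" .
  qed
  also have "\<dots> = (\<Sum>i\<in>I. x i * (\<Sum>l\<in>exponents I (Suc n). coef (l(i := l i - 1)) I * mon (l(i := l i - 1))))"
    by (subst sum.swap) (simp add: sum_distrib_left)
  also have "\<dots> = (\<Sum>i\<in>I. x i * ((\<Sum>l\<in>exponents I n. coef l I * mon l) + (\<Sum>l\<in>exponents (I - {i}) n. coef l I * mon l)))"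
  proof (rule sum.cong[OF refl])
    fix i assume "i \<in> I"
    from sum_exponents_decrement[OF fin this, where g="\<lambda>l. coef l I * mon l"]
    show "x i * (\<Sum>l\<in>exponents I (Suc n). coef (l(i := l i - 1)) I * mon (l(i := l i - 1))) =
       x i * ((\<Sum>l\<in>exponents I n. coef l I * mon l) + (\<Sum>l\<in>exponents (I - {i}) n. coef l I * mon l))"
      by (rule arg_cong)
  qed
  also have "\<dots> = sum x I * (\<Sum>l\<in>exponents I n. coef l I * mon l) + (\<Sum>i\<in>I. x i * (\<Sum>l\<in>exponents (I - {i}) n. coef l I * mon l))"
    by (simp add: distrib_left sum.distrib sum_distrib_right)
  also have "of_nat (fact n) * \<dots> = sum x I * coef_form x n I +
    (\<Sum>i\<in>I. x i * (of_nat (fact n) * (\<Sum>l\<in>exponents (I - {i}) n. coef l I * mon l)))"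
    unfolding coef_form_def mon_eq by (simp add: distrib_left sum_distrib_left mult.left_commute)
  also have "(\<Sum>i\<in>I. x i * (of_nat (fact n) * (\<Sum>l\<in>exponents (I - {i}) n. coef l I * mon l))) =
    (\<Sum>i\<in>I. - ((-1) ^ card I) * (x i * (\<Prod>j\<in>I-{i}. inv_sign i j) * coef_form x n (I - {i})))"
    unfolding coef_form_def by (intro sum.cong refl) (simp add: sub)
  also have "sum x I * coef_form x n I + \<dots> = sum x I * coef_form x n I -
    (-1) ^ card I * (\<Sum>i\<in>I. x i * (\<Prod>j\<in>I-{i}. inv_sign i j) * coef_form x n (I - {i}))"
    unfolding sum_distrib_left[symmetric] by simp
  finally show ?thesis .
qed

text \<open>\<open>I\<close> is generalised because the recurrence passes to \<open>I - {i}\<close>.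
  At \<open>n = 0\<close> both sides are 1 for empty \<open>I\<close> and 0 otherwise.\<close>

lemma subset_sum_form_power:
  fixes x :: "'b::linorder \<Rightarrow> 'a::field"
  assumes two: "(2::'a) \<noteq> 0" and "finite I" "inj_on x I"
    and "\<And>i j. i \<in> I \<Longrightarrow> j \<in> I \<Longrightarrow> i \<noteq> j \<Longrightarrow> x i + x j \<noteq> 0"
    and "\<And>k. 0 < k \<Longrightarrow> k \<le> n \<Longrightarrow> of_nat k \<noteq> (0::'a)"
  shows "subset_sum_form x (\<lambda>s. s ^ n) I = coef_form x n I"
  using assms(2-)
proof (induction n arbitrary: I)
  case 0
  show ?case
  proof (cases "I = {}")
    case True
    have "exponents {} 0 = {\<lambda>_::'b. 0}" by (auto simp: exponents_def)
    then show ?thesis using True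
      by (simp add: subset_sum_form_def coef_form_def split_weight_def cross_sign_def coef_def)
  next
    case False
    then have "exponents I 0 = {}" using 0(1) by (auto simp: exponents_def)
    then show ?thesis using subset_sum_form_1[OF two 0(1) False 0(2,3)] by (simp add: coef_form_def)
  qed
next
  case (Suc n)
  have IH: "subset_sum_form x (\<lambda>s. s ^ n) J = coef_form x n J" if "J \<subseteq> I" for J
    using Suc.prems that by (intro Suc.IH) (auto intro: finite_subset inj_on_subset)
  have "subset_sum_form x (\<lambda>s. s ^ Suc n) I = sum x I * subset_sum_form x (\<lambda>s. s ^ n) I -
    (-1) ^ card I * (\<Sum>i\<in>I. x i * (\<Prod>j\<in>I-{i}. inv_sign i j) * subset_sum_form x (\<lambda>s. s ^ n) (I - {i}))"
    using two Suc.prems by (intro subset_sum_form_power_Suc)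
  also have "\<dots> = sum x I * coef_form x n I -
    (-1) ^ card I * (\<Sum>i\<in>I. x i * (\<Prod>j\<in>I-{i}. inv_sign i j) * coef_form x n (I - {i}))"
    by (simp only: IH Diff_subset subset_refl)
  also have "\<dots> = coef_form x (Suc n) I"
    using two Suc.prems by (intro coef_form_Suc[symmetric])
  finally show ?case .
qed

section \<open>Extraction of the top coefficient\<close>

text \<open>The weights built here are those of the divided difference on \<open>B\<close>; on
  polynomials of degree at most \<open>t\<close> it reads off the coefficient of degree
  \<open>t\<close>.\<close>

lemma coefficient_functional_aux:
  fixes B :: "'a::field set"
  assumes "finite B" "card B = Suc t"
  shows "\<exists>u. \<forall>s\<le>t. (\<Sum>b\<in>B. u b * b ^ s) = (if s = t then 1 else 0)"
  using assms
proof (induction t arbitrary: B)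
  case 0
  then obtain b where "B = {b}" by (auto simp: card_Suc_eq)
  then show ?case by (intro exI[of _ "\<lambda>_. 1"]) auto
next
  case (Suc t)
  from Suc.prems obtain a C where B: "B = insert a C" "a \<notin> C" "card C = Suc t" "finite C"
    by (metis card_Suc_eq finite_insert)
  from Suc.IH[OF B(4,3)] obtain u where u: "\<And>s. s \<le> t \<Longrightarrow> (\<Sum>b\<in>C. u b * b ^ s) = (if s = t then 1 else 0)"
    by blast
  \<comment> \<open>The value at \<open>a\<close> makes the total weight 0; elsewhere division by
    \<open>b - a\<close> gives the moment recursion \<open>vS\<close>.\<close>
  define v where "v = (\<lambda>b. if b = a then - (\<Sum>b\<in>C. u b / (b - a)) else u b / (b - a))"
  have v0: "(\<Sum>b\<in>B. v b * b ^ 0) = 0"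
  proof -
    have "(\<Sum>b\<in>C. v b) = (\<Sum>b\<in>C. u b / (b - a))" using B(2) by (intro sum.cong) (auto simp: v_def)
    then show ?thesis using B by (simp add: v_def)
  qed
  have vS: "(\<Sum>b\<in>B. v b * b ^ Suc s) = a * (\<Sum>b\<in>B. v b * b ^ s) + (\<Sum>b\<in>C. u b * b ^ s)" for s
  proof -
    have "(\<Sum>b\<in>B. v b * b ^ Suc s) - a * (\<Sum>b\<in>B. v b * b ^ s) = (\<Sum>b\<in>B. v b * (b - a) * b ^ s)"
      by (simp add: sum_distrib_left algebra_simps flip: sum_subtractf)
    also have "\<dots> = (\<Sum>b\<in>C. v b * (b - a) * b ^ s)" using B by simp
    also have "\<dots> = (\<Sum>b\<in>C. u b * b ^ s)" using B(2) by (intro sum.cong) (auto simp: v_def)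
    finally show ?thesis by (simp add: algebra_simps)
  qed
  have "(\<Sum>b\<in>B. v b * b ^ s) = (if s = Suc t then 1 else 0)" if "s \<le> Suc t" for s
    using that
  proof (induction s)
    case 0
    show ?case using v0 by simp
  next
    case (Suc s)
    then have "(\<Sum>b\<in>B. v b * b ^ s) = 0" by simp
    then show ?case using u[of s] Suc.prems unfolding vS by auto
  qed
  then show ?case by blast
qed

lemma coefficient_functional:
  fixes B :: "'a::field set"
  assumes "finite B" "t < card B"
  shows "\<exists>u. \<forall>s\<le>t. (\<Sum>b\<in>B. u b * b ^ s) = (if s = t then 1 else 0)"
proof -
  obtain C where C: "C \<subseteq> B" "card C = Suc t" "finite C"
    using assms obtain_subset_with_card_n[of "Suc t" B] by auto
  from coefficient_functional_aux[OF C(3,2)] obtain u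
    where u: "\<And>s. s \<le> t \<Longrightarrow> (\<Sum>b\<in>C. u b * b ^ s) = (if s = t then 1 else 0)" by blast
  have "(\<Sum>b\<in>B. (if b \<in> C then u b else 0) * b ^ s) = (\<Sum>b\<in>C. u b * b ^ s)" for s
    using C assms(1) by (intro sum.mono_neutral_cong_right) auto
  then show ?thesis using u by (intro exI[of _ "\<lambda>b. if b \<in> C then u b else 0"]) simp
qed

section \<open>Vanishing at points with coordinates in A or equal to 0\<close>

lemma coef_form_eq_0_if_zero:
  assumes "finite I" "i \<in> I" "x i = 0"
  shows "coef_form x n I = 0"
proof -
  have "(\<Prod>i\<in>I. x i ^ l i) = 0" if "l \<in> exponents I n" for l
    using assms that by (intro prod_zero bexI[of _ i]) (auto simp: exponents_def)
  then show ?thesis by (simp add: coef_form_def)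
qed

text \<open>Transposing \<open>a\<close> and \<open>b\<close> permutes the exponent vectors and
  negates \<open>coef\<close>, but keeps the value of each monomial because
  \<open>x a = x b\<close>; hence the sum equals its own negative.\<close>

lemma coef_form_eq_0_if_equal:
  fixes x :: "'b::linorder \<Rightarrow> 'a::field"
  assumes two: "(2::'a) \<noteq> 0" and fin: "finite I" and ab: "a \<in> I" "b \<in> I" "a \<noteq> b" and eq: "x a = x b"
  shows "coef_form x n I = 0"
proof -
  let ?t = "Transposition.transpose a b"
  have tI: "?t i \<in> I \<longleftrightarrow> i \<in> I" for i using ab by (auto simp: transpose_def)
  have xt: "x (?t i) = x i" for i using eq by (auto simp: transpose_def)
  have sum: "(\<Sum>i\<in>I. l (?t i)) = sum l I" for l :: "'b \<Rightarrow> nat"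
    by (rule sum.reindex_bij_witness[where i="?t" and j="?t"]) (auto simp: tI)
  have mem: "l \<circ> ?t \<in> exponents I n" if "l \<in> exponents I n" for l
    using that by (simp add: exponents_def sum tI)
  define S where "S = (\<Sum>l\<in>exponents I n. coef l I * (\<Prod>i\<in>I. x i ^ l i))"
  have "S = (\<Sum>l\<in>exponents I n. coef (l \<circ> ?t) I * (\<Prod>i\<in>I. x i ^ (l \<circ> ?t) i))"
    unfolding S_def
    by (rule sum.reindex_bij_witness[where i="\<lambda>l. l \<circ> ?t" and j="\<lambda>l. l \<circ> ?t"]) (auto simp: mem comp_assoc)
  also have "\<dots> = (\<Sum>l\<in>exponents I n. - (coef l I * (\<Prod>i\<in>I. x i ^ l i)))"
  proof (rule sum.cong[OF refl])
    fix l
    have "(\<Prod>i\<in>I. x i ^ (l \<circ> ?t) i) = (\<Prod>i\<in>I. x (?t i) ^ l (?t i))" by (simp add: xt)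
    also have "\<dots> = (\<Prod>i\<in>I. x i ^ l i)" using ab(1,2) by (rule prod_transpose)
    finally show "coef (l \<circ> ?t) I * (\<Prod>i\<in>I. x i ^ (l \<circ> ?t) i) = - (coef l I * (\<Prod>i\<in>I. x i ^ l i))"
      by (simp only: coef_swap[OF fin ab]) simp
  qed
  also have "\<dots> = - S" by (simp add: S_def sum_negf)
  finally have "2 * S = 0" by (simp add: eq_neg_iff_add_eq_0)
  then show ?thesis using two by (simp add: coef_form_def S_def)
qed

text \<open>For distinct nonzero \<open>x i\<close>, the power identity turns the sum into a
  weighted sum of \<open>poly f\<close> at subset sums, all of them roots. With a zero or repeated
  coordinate each \<open>coef_form\<close> already vanishes.\<close>

lemma coef_form_poly_vanishes:
  fixes A :: "'a::field set" and x :: "'b::linorder \<Rightarrow> 'a"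
  assumes two: "(2::'a) \<noteq> 0" and sep: "A \<inter> uminus ` A = {}" and fin: "finite I"
    and x: "\<And>i. i \<in> I \<Longrightarrow> x i \<in> insert 0 A"
    and f: "\<And>B. finite B \<Longrightarrow> B \<subseteq> A \<Longrightarrow> card B \<le> card I \<Longrightarrow> poly f (\<Sum>B) = 0"
    and char: "\<And>k. 0 < k \<Longrightarrow> k \<le> degree f \<Longrightarrow> of_nat k \<noteq> (0::'a)"
  shows "(\<Sum>n\<le>degree f. coeff f n * coef_form x n I) = 0"
proof (cases "inj_on x I \<and> 0 \<notin> x ` I")
  case False
  have "coef_form x n I = 0" for n
  proof (cases "0 \<in> x ` I")
    case True
    then obtain i where "i \<in> I" "x i = 0" by auto
    with fin show ?thesis by (rule coef_form_eq_0_if_zero)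
  next
    case no_zero: False
    then obtain a b where "a \<in> I" "b \<in> I" "a \<noteq> b" "x a = x b" using False by (auto simp: inj_on_def)
    with two fin show ?thesis by (rule coef_form_eq_0_if_equal)
  qed
  then show ?thesis by simp
next
  case True
  then have xA: "x i \<in> A" if "i \<in> I" for i using x[OF that] that by (metis image_eqI insertE)
  have nz: "x i + x j \<noteq> 0" if "i \<in> I" "j \<in> I" for i j
  proof
    assume "x i + x j = 0"
    then have "x i = - x j" by (simp add: eq_neg_iff_add_eq_0)
    then show False using xA that sep by auto
  qed
  have "(\<Sum>n\<le>degree f. coeff f n * coef_form x n I) = (\<Sum>n\<le>degree f. coeff f n * subset_sum_form x (\<lambda>s. s ^ n) I)"
  proof (intro sum.cong refl arg_cong2[where f="(*)"])
    fix n assume "n \<in> {..degree f}"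
    then have "n \<le> degree f" by simp
    then show "coef_form x n I = subset_sum_form x (\<lambda>s. s ^ n) I"
      using True nz char by (intro subset_sum_form_power[OF two fin, symmetric]) (blast intro: order_trans)+
  qed
  also have "\<dots> = (\<Sum>n\<le>degree f. \<Sum>T\<in>Pow I. split_weight x (I - T) T * (coeff f n * sum x (I - T) ^ n))"
    by (simp add: subset_sum_form_def sum_distrib_left mult_ac)
  also have "\<dots> = (\<Sum>T\<in>Pow I. split_weight x (I - T) T * poly f (sum x (I - T)))"
    by (subst sum.swap) (simp add: poly_altdef sum_distrib_left)
  also have "\<dots> = 0"
  proof (rule sum.neutral, rule ballI)
    fix T assume "T \<in> Pow I"
    define B where "B = x ` (I - T)"
    have inj: "inj_on x (I - T)" using True by (auto intro: inj_on_subset)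
    have "\<Sum>B = sum x (I - T)" unfolding B_def by (subst sum.reindex[OF inj]) simp
    moreover have "poly f (\<Sum>B) = 0"
    proof (rule f)
      show "card B \<le> card I" unfolding B_def card_image[OF inj] using fin by (intro card_mono) auto
    qed (use fin xA in \<open>auto simp: B_def\<close>)
    ultimately show "split_weight x (I - T) T * poly f (sum x (I - T)) = 0" by simp
  qed
  finally show ?thesis .
qed

lemma of_nat_fact_nonzero:
  assumes "\<And>k. 0 < k \<Longrightarrow> k \<le> m \<Longrightarrow> of_nat k \<noteq> (0::'a::field)" "n \<le> m"
  shows "of_nat (fact n) \<noteq> (0::'a)"
  using assms(2)
proof (induction n)
  case (Suc n)
  then have "of_nat (Suc n) \<noteq> (0::'a)" by (intro assms(1)) auto
  then show ?case using Suc by (simp only: fact_Suc of_nat_mult of_nat_id) simp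
qed simp

text \<open>Otherwise some polynomial of degree exactly \<open>m = \<Sum>I\<close> vanishes on
  \<open>C\<close>. A functional \<open>L\<close> that extracts the coefficient of
  \<open>\<Prod>i\<in>I. x i ^ i\<close> then gives 0 on the vanishing combination, yet also a
  nonzero multiple of \<open>coef \<kappa> I\<close>, which is nonzero.\<close>

lemma card_subset_sums_gt:
  fixes A :: "'a::field set" and I :: "nat set"
  assumes finA: "finite A" and sep: "A \<inter> uminus ` A = {}" and I: "I \<subseteq> {1..card A}"
    and char: "\<And>k. 0 < k \<Longrightarrow> k \<le> \<Sum>I \<Longrightarrow> of_nat k \<noteq> (0::'a)"
    and finC: "finite C" and C: "\<And>B. B \<subseteq> A \<Longrightarrow> card B \<le> card I \<Longrightarrow> \<Sum>B \<in> C"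
  shows "\<Sum>I < card C"
proof (rule ccontr)
  assume "\<not> \<Sum>I < card C"
  define m where "m = \<Sum>I"
  have m: "card C \<le> m" using \<open>\<not> \<Sum>I < card C\<close> by (simp add: m_def)
  have finI: "finite I" using I finite_subset by blast
  \<comment> \<open>The empty sum lies in \<open>C\<close>, so \<open>m > 0\<close> and
    \<open>A\<close> is nonempty; an element of \<open>A\<close> then rules out characteristic
    2.\<close>
  have "C \<noteq> {}" using C[of "{}"] by auto
  then have "m > 0" using m finC by (metis card_gt_0_iff le_zero_eq neq0_conv)
  then have "I \<noteq> {}" by (auto simp: m_def)
  then have "A \<noteq> {}" using I by auto
  then obtain a where a: "a \<in> A" by auto
  have two: "(2::'a) \<noteq> 0"
  proof
    assume "(2::'a) = 0"
    then have "a + a = 0" by (metis mult_2 mult_zero_left)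
    then have "a = - a" by (simp add: eq_neg_iff_add_eq_0)
    then show False using a sep by (metis IntI empty_iff image_eqI)
  qed
  have zA: "0 \<notin> A" using sep by force
  \<comment> \<open>The power of the variable pads the degree to exactly \<open>m\<close>.\<close>
  define f where "f = (\<Prod>c\<in>C. [:- c, 1:]) * monom 1 (m - card C)"
  have nz: "(\<Prod>c\<in>C. [:- c, 1:]) \<noteq> 0" using finC by simp
  have "degree (\<Prod>c\<in>C. [:- c, 1:]) = card C"
    by (subst degree_prod_eq_sum_degree) auto
  then have deg: "degree f = m"
    unfolding f_def using m nz by (subst degree_mult_eq) (auto simp: degree_monom_eq monom_eq_0_iff)
  have "f \<noteq> 0" using nz by (auto simp: f_def monom_eq_0_iff)
  then have lead: "coeff f m \<noteq> 0" using deg by (metis leading_coeff_0_iff)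
  have root: "poly f c = 0" if "c \<in> C" for c
    using that finC by (auto simp: f_def poly_prod)
  define \<kappa> where "\<kappa> = (\<lambda>i. if i \<in> I then i else 0)"
  let ?A0 = "insert 0 A"
  have "\<exists>u. \<forall>s\<le>i. (\<Sum>b\<in>?A0. u b * b ^ s) = (if s = i then 1 else 0)" if "i \<in> I" for i
  proof -
    \<comment> \<open>Since \<open>0 \<notin> A\<close>, adjoining 0 supplies the extra point needed
      for the largest possible exponent \<open>i = card A\<close>.\<close>
    have "i < card ?A0" using I that finA zA by auto
    moreover have "finite ?A0" using finA by simp
    ultimately show ?thesis by (intro coefficient_functional)
  qed
  then obtain u where u: "\<And>i s. i \<in> I \<Longrightarrow> s \<le> i \<Longrightarrow> (\<Sum>b\<in>?A0. u i b * b ^ s) = (if s = i then 1 else 0)"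
    by metis
  \<comment> \<open>\<open>L\<close> is the tensor product of the one-variable functionals, so it
    factors on monomials.\<close>
  define L where "L = (\<lambda>g :: (nat \<Rightarrow> 'a) \<Rightarrow> 'a. \<Sum>x\<in>PiE I (\<lambda>_. ?A0). (\<Prod>i\<in>I. u i (x i)) * g x)"
  have L_mon: "L (\<lambda>x. \<Prod>i\<in>I. x i ^ l i) = (\<Prod>i\<in>I. \<Sum>b\<in>?A0. u i b * b ^ l i)" for l
    unfolding L_def using finI finA by (subst prod_sum_PiE) (auto simp: prod.distrib)
  \<comment> \<open>Either some \<open>l i\<close> falls short of \<open>i\<close> and its factor is
    0, or all reach \<open>i\<close> and the degree bound \<open>m\<close> forces equality. So an
    exponent above its index, where \<open>u\<close> is uncontrolled, comes with another one
    below.\<close>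
  have L_exp: "L (\<lambda>x. \<Prod>i\<in>I. x i ^ l i) = (if l = \<kappa> then 1 else 0)" if l: "l \<in> exponents I n" "n \<le> m" for l n
  proof (cases "\<exists>i\<in>I. l i < i")
    case True
    then obtain i where i: "i \<in> I" "l i < i" by auto
    then have "(\<Sum>b\<in>?A0. u i b * b ^ l i) = 0" using u[of i "l i"] by simp
    moreover have "l \<noteq> \<kappa>" using i by (auto simp: \<kappa>_def)
    ultimately show ?thesis unfolding L_mon using finI i by (auto intro!: prod_zero)
  next
    case False
    then have ge: "i \<le> l i" if "i \<in> I" for i using that by force
    have "sum l I \<le> \<Sum>I" using l by (simp add: exponents_def m_def)
    then have "sum l I = (\<Sum>i\<in>I. i)" using sum_mono[of I "\<lambda>i. i" l] ge by simp
    then have li: "l i = i" if "i \<in> I" for i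
      using sum_mono_inv[of "\<lambda>i. i" I l i] ge finI that by simp
    then have "l = \<kappa>" using l by (auto simp: \<kappa>_def exponents_def fun_eq_iff)
    moreover have "(\<Sum>b\<in>?A0. u i b * b ^ l i) = 1" if "i \<in> I" for i
      using u[of i "l i"] li[OF that] that by simp
    ultimately show ?thesis unfolding L_mon by simp
  qed
  have L_form: "L (\<lambda>x. coef_form x n I) = (if n = m then of_nat (fact m) * coef \<kappa> I else 0)" if "n \<le> m" for n
  proof -
    have "L (\<lambda>x. coef_form x n I) = of_nat (fact n) * (\<Sum>l\<in>exponents I n. coef l I * L (\<lambda>x. \<Prod>i\<in>I. x i ^ l i))"
      unfolding L_def coef_form_def sum_distrib_left
      by (subst (2) sum.swap) (simp only: mult.assoc mult.commute mult.left_commute)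
    also have "(\<Sum>l\<in>exponents I n. coef l I * L (\<lambda>x. \<Prod>i\<in>I. x i ^ l i)) = (\<Sum>l\<in>exponents I n. if l = \<kappa> then coef \<kappa> I else 0)"
      using L_exp[OF _ that] by (intro sum.cong refl) auto
    also have "\<dots> = (if \<kappa> \<in> exponents I n then coef \<kappa> I else 0)"
      using finI by (simp add: finite_exponents sum.delta)
    also have "\<kappa> \<in> exponents I n \<longleftrightarrow> n = m"
    proof -
      have "sum \<kappa> I = m" unfolding m_def by (intro sum.cong) (auto simp: \<kappa>_def)
      moreover have "0 < \<kappa> i \<longleftrightarrow> i \<in> I" for i using I by (force simp: \<kappa>_def)
      ultimately show ?thesis by (auto simp: exponents_def)
    qed
    finally show ?thesis by auto
  qed
  have "L (\<lambda>x. \<Sum>n\<le>m. coeff f n * coef_form x n I) = (\<Sum>n\<le>m. coeff f n * L (\<lambda>x. coef_form x n I))"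
    unfolding L_def sum_distrib_left by (subst sum.swap) (simp only: mult.left_commute)
  also have "\<dots> = (\<Sum>n\<le>m. if n = m then coeff f m * (of_nat (fact m) * coef \<kappa> I) else 0)"
    by (intro sum.cong refl) (auto simp: L_form)
  also have "\<dots> = coeff f m * (of_nat (fact m) * coef \<kappa> I)" by simp
  finally have L1: "L (\<lambda>x. \<Sum>n\<le>m. coeff f n * coef_form x n I) = coeff f m * (of_nat (fact m) * coef \<kappa> I)" .
  have "(\<Sum>n\<le>m. coeff f n * coef_form x n I) = 0" if "x \<in> PiE I (\<lambda>_. ?A0)" for x
    unfolding deg[symmetric]
  proof (rule coef_form_poly_vanishes[OF two sep finI])
    show "x i \<in> ?A0" if "i \<in> I" for i using \<open>x \<in> PiE I (\<lambda>_. ?A0)\<close> that by (rule PiE_mem)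
    show "poly f (\<Sum>B) = 0" if "B \<subseteq> A" "card B \<le> card I" for B using C[OF that] by (rule root)
    show "of_nat k \<noteq> (0::'a)" if "0 < k" "k \<le> degree f" for k
      using char that deg by (simp add: m_def)
  qed
  then have "L (\<lambda>x. \<Sum>n\<le>m. coeff f n * coef_form x n I) = 0" by (simp add: L_def)
  moreover have fact: "of_nat (fact n) \<noteq> (0::'a)" if "n \<le> m" for n
    using char that unfolding m_def by (rule of_nat_fact_nonzero)
  from fact[OF order_refl] have "of_nat (fact m) \<noteq> (0::'a)" .
  \<comment> \<open>The exponents are distinct, and they and their pair sums lie between 1 and
    \<open>m\<close>, hence below a positive characteristic.\<close>
  moreover have "coef \<kappa> I \<noteq> (0::'a)"
  proof -
    have le: "i \<le> m" if "i \<in> I" for i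
      unfolding m_def using member_le_sum[of i I "\<lambda>i. i"] that finI by simp
    have pos: "0 < i" if "i \<in> I" for i using that I by auto
    have "omega (\<lambda>i. of_nat (\<kappa> i)) I = omega (\<lambda>i. of_nat i :: 'a) I" by (rule omega_cong) (simp add: \<kappa>_def)
    moreover have "omega (\<lambda>i. of_nat i :: 'a) I \<noteq> 0"
    proof (rule omega_nonzero[OF finI])
      show "inj_on (\<lambda>i. of_nat i :: 'a) I"
      proof (rule inj_onI)
        fix i j assume "i \<in> I" "j \<in> I" "of_nat i = (of_nat j :: 'a)"
        then show "i = j" using char le unfolding m_def by (intro of_nat_eq_imp_eq[of "\<Sum>I"])
      qed
      fix i j assume ij: "i \<in> I" "j \<in> I" "i \<noteq> j"
      have "sum (\<lambda>i. i) {i, j} \<le> sum (\<lambda>i. i) I" using ij finI by (intro sum_mono2) auto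
      then have "of_nat (i + j) \<noteq> (0::'a)" using ij pos by (intro char) auto
      then show "of_nat i + of_nat j \<noteq> (0::'a)" by simp
    qed
    moreover have "(\<Prod>i\<in>I. of_nat (fact (\<kappa> i))) \<noteq> (0::'a)"
      using finI le fact by (simp add: \<kappa>_def)
    ultimately show ?thesis by (simp add: coef_def)
  qed
  ultimately show False using L1 lead by simp
qed

section \<open>Subsums of a set of residues\<close>

text \<open>Greedy choice: for \<open>m \<le> d\<close> at most one element suffices; otherwise
  \<open>d\<close> is taken and the rest is found in \<open>{1..d - 1}\<close>.\<close>

lemma subset_with_sum:
  assumes "k \<le> d" "m \<le> (\<Sum>j<k. d - j)"
  shows "\<exists>K\<subseteq>{1..d}. card K \<le> k \<and> \<Sum>K = m"
  using assms
proof (induction k arbitrary: d m)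
  case 0
  then show ?case by (intro exI[of _ "{}"]) auto
next
  case (Suc k)
  show ?case
  proof (cases "m \<le> d")
    case True
    then show ?thesis by (intro exI[of _ "if m = 0 then {} else {m}"]) auto
  next
    case False
    obtain e where e: "d = Suc e" using Suc.prems by (cases d) auto
    have "(\<Sum>j<Suc k. d - j) = d + (\<Sum>j<k. e - j)" unfolding sum.lessThan_Suc_shift by (simp add: e)
    then have "m - d \<le> (\<Sum>j<k. e - j)" using Suc.prems by simp
    with Suc.IH[of e "m - d"] Suc.prems e obtain K where K: "K \<subseteq> {1..e}" "card K \<le> k" "\<Sum>K = m - d"
      by auto
    then have "finite K" "d \<notin> K" using e finite_subset by auto
    then show ?thesis using K False e by (intro exI[of _ "insert d K"]) auto
  qed
qed

section \<open>Subsums as sums over subsets, and complementation\<close>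

lemma restricted_sumset_eq:
  assumes "finite A"
  shows "restricted_sumset k A = (\<lambda>B. \<Sum>B) ` {B. B \<subseteq> A \<and> card B = k}"
proof (intro equalityI subsetI)
  fix s assume "s \<in> restricted_sumset k A"
  then obtain a where a: "s = (\<Sum>i=1..k. a i)" "\<forall>i\<in>{1..k}. a i \<in> A" "inj_on a {1..k}"
    unfolding restricted_sumset_def inj_on_def by blast
  have "s = \<Sum>(a ` {1..k})" using a by (simp add: sum.reindex)
  moreover have "card (a ` {1..k}) = k" using a by (simp add: card_image)
  ultimately show "s \<in> (\<lambda>B. \<Sum>B) ` {B. B \<subseteq> A \<and> card B = k}" using a by blast
next
  fix s assume "s \<in> (\<lambda>B. \<Sum>B) ` {B. B \<subseteq> A \<and> card B = k}"
  then obtain B where B: "s = \<Sum>B" "B \<subseteq> A" "card B = k" by auto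
  then have "finite B" using assms finite_subset by blast
  then obtain a where a: "bij_betw a {1..k} B" using B by (metis ex_bij_betw_nat_finite_1)
  have "s = (\<Sum>i=1..k. a i)" using sum.reindex_bij_betw[OF a, of "\<lambda>x. x"] B by simp
  moreover have "\<forall>i\<in>{1..k}. a i \<in> A" using bij_betwE[OF a] B(2) by blast
  moreover have "\<forall>i\<in>{1..k}. \<forall>j\<in>{1..k}. i \<noteq> j \<longrightarrow> a i \<noteq> a j"
    using bij_betw_imp_inj_on[OF a] unfolding inj_on_def by blast
  ultimately show "s \<in> restricted_sumset k A"
    unfolding restricted_sumset_def by (intro CollectI exI[of _ a] conjI)
qed

lemma subsums_omitting_eq:
  assumes "finite A"
  shows "subsums_omitting \<alpha> A = (\<lambda>B. \<Sum>B) ` {B. B \<subseteq> A \<and> card B \<le> card A - \<alpha>}"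
proof -
  have "{B. B \<subseteq> A \<and> card B \<le> card A - \<alpha>} = (\<Union>k\<in>{0..card A - \<alpha>}. {B. B \<subseteq> A \<and> card B = k})"
    by auto
  then show ?thesis unfolding subsums_omitting_def restricted_sumset_eq[OF assms] by (simp add: image_UN)
qed

lemma subsums_at_least_eq:
  assumes "finite A"
  shows "subsums_at_least \<alpha> A = (\<lambda>B. \<Sum>B) ` {B. B \<subseteq> A \<and> \<alpha> \<le> card B}"
proof -
  have "card B \<le> card A" if "B \<subseteq> A" for B using assms that by (rule card_mono)
  then have "{B. B \<subseteq> A \<and> \<alpha> \<le> card B} = (\<Union>k\<in>{\<alpha>..card A}. {B. B \<subseteq> A \<and> card B = k})"
    by auto
  then show ?thesis unfolding subsums_at_least_def restricted_sumset_eq[OF assms] by (simp add: image_UN)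
qed

text \<open>Passing from \<open>B\<close> to \<open>A - B\<close> acts on sums as
  \<open>s \<mapsto> \<Sum>A - s\<close>, an involution that does not depend on the choice of
  \<open>B\<close>.\<close>

lemma card_subsums_at_least:
  fixes A :: "'a::ab_group_add set"
  assumes fin: "finite A" and \<alpha>: "\<alpha> \<le> card A"
  shows "card (subsums_at_least \<alpha> A) = card (subsums_omitting \<alpha> A)"
proof (rule bij_betw_same_card[OF bij_betw_byWitness[where f="\<lambda>s. \<Sum>A - s" and f'="\<lambda>s. \<Sum>A - s"]])
  have compl: "\<Sum>A - \<Sum>B = \<Sum>(A - B)" "card (A - B) = card A - card B" "card B \<le> card A" if "B \<subseteq> A" for B
    using fin that by (auto simp: sum_diff card_Diff_subset finite_subset card_mono)
  show "(\<lambda>s. \<Sum>A - s) ` subsums_at_least \<alpha> A \<subseteq> subsums_omitting \<alpha> A"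
    unfolding subsums_at_least_eq[OF fin] subsums_omitting_eq[OF fin]
  proof (clarify)
    fix B assume "B \<subseteq> A" "\<alpha> \<le> card B"
    then show "\<Sum>A - \<Sum>B \<in> (\<lambda>B. \<Sum>B) ` {B. B \<subseteq> A \<and> card B \<le> card A - \<alpha>}"
      using compl[of B] by (intro image_eqI[of _ _ "A - B"]) auto
  qed
  show "(\<lambda>s. \<Sum>A - s) ` subsums_omitting \<alpha> A \<subseteq> subsums_at_least \<alpha> A"
    unfolding subsums_at_least_eq[OF fin] subsums_omitting_eq[OF fin]
  proof (clarify)
    fix B assume "B \<subseteq> A" "card B \<le> card A - \<alpha>"
    then show "\<Sum>A - \<Sum>B \<in> (\<lambda>B. \<Sum>B) ` {B. B \<subseteq> A \<and> \<alpha> \<le> card B}"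
      using compl[of B] \<alpha> by (intro image_eqI[of _ _ "A - B"]) auto
  qed
qed auto

lemma sum_top_eq:
  assumes "k \<le> d"
  shows "real (\<Sum>j<k. d - j) = real d * (real d + 1) / 2 - real (d - k) * (real (d - k) + 1) / 2"
  using assms
proof (induction k)
  case (Suc k)
  obtain e where e: "d = Suc k + e" using Suc.prems le_Suc_ex by blast
  have "real (\<Sum>j<Suc k. d - j) = real (\<Sum>j<k. d - j) + real (d - k)" by simp
  also have "\<dots> = real d * (real d + 1) / 2 - real (d - k) * (real (d - k) + 1) / 2 + real (d - k)"
    using Suc by simp
  also have "real (d - k) = real e + 1" using e by simp
  also have "real d * (real d + 1) / 2 - (real e + 1) * (real e + 1 + 1) / 2 + (real e + 1) =
     real d * (real d + 1) / 2 - real e * (real e + 1) / 2"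
    by (simp add: field_simps)
  also have "real e = real (d - Suc k)" using e by simp
  finally show ?case .
qed simp

theorem theorem4:
  fixes A :: "'p::prime_card mod_ring set" and \<alpha> :: nat
  assumes "A \<inter> uminus ` A = {}"
    and "\<alpha> \<le> card A"
  shows "card (subsums_at_least \<alpha> A) = card (subsums_omitting \<alpha> A) \<and>
    real (card (subsums_omitting \<alpha> A)) \<ge>
      min (real CARD('p))
        (real (card A) * (real (card A) + 1) / 2 - real \<alpha> * (real \<alpha> + 1) / 2 + 1)"
proof
  have fin: "finite X" for X :: "'p mod_ring set" by simp
  show "card (subsums_at_least \<alpha> A) = card (subsums_omitting \<alpha> A)"
    using card_subsums_at_least[OF fin assms(2)] .
  define M where "M = (\<Sum>j<card A - \<alpha>. card A - j)"
  \<comment> \<open>The cap \<open>p - 1\<close> keeps all integers from 1 to \<open>m\<close>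
    nonzero modulo \<open>p\<close>; the strict bound by the number of subsums then yields
    \<open>min p (M + 1)\<close>.\<close>
  define m where "m = min M (CARD('p) - 1)"
  have p: "CARD('p) > 0" by simp
  obtain I where I: "I \<subseteq> {1..card A}" "card I \<le> card A - \<alpha>" "\<Sum>I = m"
    using subset_with_sum[of "card A - \<alpha>" "card A" m] by (auto simp: m_def M_def)
  have "\<Sum>I < card (subsums_omitting \<alpha> A)"
  proof (rule card_subset_sums_gt[OF fin assms(1) I(1)])
    fix k assume "0 < k" "k \<le> \<Sum>I"
    then have "k < CARD('p)" using I(3) p by (auto simp: m_def)
    then show "of_nat k \<noteq> (0 :: 'p mod_ring)"
      using of_nat_0_mod_ring_dvd[where 'a='p, of k] \<open>0 < k\<close> nat_dvd_not_less by blast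
  next
    fix B assume "B \<subseteq> A" "card B \<le> card I"
    then show "\<Sum>B \<in> subsums_omitting \<alpha> A" using I(2) by (auto simp: subsums_omitting_eq[OF fin])
  qed simp
  then have "min CARD('p) (M + 1) \<le> card (subsums_omitting \<alpha> A)"
    using p by (auto simp: I(3) m_def)
  then have "min (real CARD('p)) (real M + 1) \<le> real (card (subsums_omitting \<alpha> A))"
    by (simp add: min_def split: if_splits)
  moreover have "real M = real (card A) * (real (card A) + 1) / 2 - real \<alpha> * (real \<alpha> + 1) / 2"
    unfolding M_def using sum_top_eq[of "card A - \<alpha>" "card A"] assms(2) by simp
  ultimately show "min (real CARD('p))
        (real (card A) * (real (card A) + 1) / 2 - real \<alpha> * (real \<alpha> + 1) / 2 + 1)
      \<le> real (card (subsums_omitting \<alpha> A))" by simp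
qed

end
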